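(* Let $\mathcal{T}$ be a triangle with circumcircle $\mathcal{C}$, and let $D$ be a point lying neither on the sides of $\mathcal{T}$ nor on $\mathcal{C}$. Let $\mathcal{T}_D$ be the negative-pedal triangle of $\mathcal{T}$ with respect to $D$, and $\mathcal{C}_D$ the circumcircle of $\mathcal{T}_D$. Then $(\mathcal{C},\mathcal{C}_D)$ form a negative-pedal poristic pair of circles, in the following sense. From any point $A$ on $\mathcal{C}$, let the perpendicular through $A$ to $DA$ intersect $\mathcal{C}_D$ in two distinct points $B'$ and $C'$. Let the circles of diameters $[B'D]$ and $[C'D]$ intersect $\mathcal{C}$ again in $C$ and $B$, respectively. Finally, let $A'$ be the intersection of $BC'$ and $CB'$. Then: (i) $A'$ lies on the circle $\mathcal{C}_D$; (ii) triangle $A'B'C'$ shares with $\mathcal{T}_D$ the same circumcircle and the same pedal-circle $\mathcal{C}$ (with respect to $D$). If the perpendicular through $A$ to $DA$ does not intersect $\mathcal{C}_D$ in two distinct points, there is no such triangle with a vertex at $A$. This occurs if and only if $A$ is located on an infertile arc $D_1D_2$ of $\mathcal{C}$ located inside $\gamma_D$, the i-conic of $\mathcal{T}$ focused in $D$.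
   Context: All objects are in the Euclidean plane. A "side" of a triangle means the line through two of its vertices. For a point $D$ neither on the sides nor on the circumcircle of a triangle, the negative-pedal triangle with respect to $D$ is the triangle whose sides are the perpendiculars, through each vertex $V$ of the given triangle, to the line $DV$; its circumcircle is the negative-pedal circle. The pedal-circle of a triangle with respect to $D$ is the circle through the projections of $D$ on its sides. The i-conic of $\mathcal{T}$ focused in $D$ is the conic having $D$ as a focus and tangent to the three sides of $\mathcal{T}$. Points inside a conic are those lying in the same connected component of the plane (minus the conic) as one of its foci. $D_1,D_2$ denote points where $\mathcal{C}$ meets $\gamma_D$, and $D_1D_2$ the arc of $\mathcal{C}$ they delimit that lies inside $\gamma_D$; it is called infertile because it contains no vertices of triangles $ABC$ of the kind constructed. "Such triangle" refers to the triangle $ABC$ of the construction, inscribed in $\mathcal{C}$ with negative-pedal circle $\mathcal{C}_D$. *)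

theory Defs
  imports "HOL-Analysis.Analysis"
begin

type_synonym point = "real^2"

definition sides :: "point \<Rightarrow> point \<Rightarrow> point \<Rightarrow> point set set" where
  "sides P Q R = {affine hull {P, Q}, affine hull {Q, R}, affine hull {R, P}}"

definition is_circle :: "point set \<Rightarrow> bool" where
  "is_circle K \<longleftrightarrow> (\<exists>c r. 0 < r \<and> K = sphere c r)"

definition diameter_circle :: "point \<Rightarrow> point \<Rightarrow> point set" where
  "diameter_circle X Y = sphere (midpoint X Y) (dist X Y / 2)"

(* This includes the requirement that P, Q, R are the vertices of a nondegenerate triangle. *)
definition is_circumcircle :: "point set \<Rightarrow> point \<Rightarrow> point \<Rightarrow> point \<Rightarrow> bool" where
  "is_circumcircle K P Q R \<longleftrightarrow> \<not> collinear {P, Q, R} \<and> is_circle K \<and> {P, Q, R} \<subseteq> K"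

(* The perpendicular through V to the line DV; it is a line when V \<noteq> D. *)
definition perp_line :: "point \<Rightarrow> point \<Rightarrow> point set" where
  "perp_line D V = {X. orthogonal (X - V) (V - D)}"

(* P', Q', R' are the vertices opposite to the sides through P, Q, R respectively. *)
definition is_negative_pedal_triangle ::
    "point \<Rightarrow> point \<Rightarrow> point \<Rightarrow> point \<Rightarrow> point \<Rightarrow> point \<Rightarrow> point \<Rightarrow> bool" where
  "is_negative_pedal_triangle D P Q R P' Q' R' \<longleftrightarrow>
     perp_line D Q \<inter> perp_line D R = {P'} \<and>
     perp_line D R \<inter> perp_line D P = {Q'} \<and>
     perp_line D P \<inter> perp_line D Q = {R'}"

definition is_negative_pedal_circle ::
    "point set \<Rightarrow> point \<Rightarrow> point \<Rightarrow> point \<Rightarrow> point \<Rightarrow> bool" where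
  "is_negative_pedal_circle K D P Q R \<longleftrightarrow>
     (\<exists>P' Q' R'. is_negative_pedal_triangle D P Q R P' Q' R' \<and> is_circumcircle K P' Q' R')"

definition is_projection :: "point \<Rightarrow> point \<Rightarrow> point \<Rightarrow> point \<Rightarrow> bool" where
  "is_projection F D X Y \<longleftrightarrow> F \<in> affine hull {X, Y} \<and> orthogonal (D - F) (Y - X)"

definition is_pedal_circle :: "point set \<Rightarrow> point \<Rightarrow> point \<Rightarrow> point \<Rightarrow> point \<Rightarrow> bool" where
  "is_pedal_circle K D X Y Z \<longleftrightarrow>
     (\<exists>U V W. is_projection U D Y Z \<and> is_projection V D Z X \<and> is_projection W D X Y \<and>
        is_circumcircle K U V W)"

(* \<gamma> is a nondegenerate conic and \<Phi> is the set of its foci: ellipse (with F = G for a circle,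
   whose only focus is its centre), hyperbola (both branches), or parabola with directrix UV. *)
definition is_conic_with_foci :: "point set \<Rightarrow> point set \<Rightarrow> bool" where
  "is_conic_with_foci \<gamma> \<Phi> \<longleftrightarrow>
     (\<exists>F G a. dist F G < 2 * a \<and> \<Phi> = {F, G} \<and> \<gamma> = {X. dist X F + dist X G = 2 * a}) \<or>
     (\<exists>F G a. 0 < a \<and> 2 * a < dist F G \<and> \<Phi> = {F, G} \<and>
        \<gamma> = {X. \<bar>dist X F - dist X G\<bar> = 2 * a}) \<or>
     (\<exists>F U V. U \<noteq> V \<and> F \<notin> affine hull {U, V} \<and> \<Phi> = {F} \<and>
        \<gamma> = {X. dist X F = infdist X (affine hull {U, V})})"

(* The line l passes through a point p 0 of \<gamma>, in the direction of the velocity at that point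
   of some curve p running in \<gamma>. *)
definition touches :: "point set \<Rightarrow> point set \<Rightarrow> bool" where
  "touches l \<gamma> \<longleftrightarrow>
     (\<exists>(p :: real \<Rightarrow> point) v e. 0 < e \<and> (\<forall>t. \<bar>t\<bar> < e \<longrightarrow> p t \<in> \<gamma>) \<and>
        (p has_vector_derivative v) (at 0) \<and> v \<noteq> 0 \<and> l = range (\<lambda>s. p 0 + s *\<^sub>R v))"

definition is_asymptote :: "point set \<Rightarrow> point set \<Rightarrow> bool" where
  "is_asymptote l \<gamma> \<longleftrightarrow>
     (\<exists>X :: nat \<Rightarrow> point. (\<forall>n. X n \<in> \<gamma>) \<and> filterlim X at_infinity sequentially \<and>
        (\<lambda>n. infdist (X n) l) \<longlonglongrightarrow> 0)"

(* A conic is tangent to its asymptotes, at points at infinity. For exceptional positions of the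
   focus a side of the triangle is an asymptote of the inscribed hyperbola; without the second
   alternative no conic would be tangent to the three sides in these cases. *)
definition is_tangent_line :: "point set \<Rightarrow> point set \<Rightarrow> bool" where
  "is_tangent_line l \<gamma> \<longleftrightarrow> touches l \<gamma> \<or> is_asymptote l \<gamma>"

definition is_i_conic ::
    "point set \<Rightarrow> point set \<Rightarrow> point \<Rightarrow> point \<Rightarrow> point \<Rightarrow> point \<Rightarrow> bool" where
  "is_i_conic \<gamma> \<Phi> D P Q R \<longleftrightarrow>
     is_conic_with_foci \<gamma> \<Phi> \<and> D \<in> \<Phi> \<and> (\<forall>l\<in>sides P Q R. is_tangent_line l \<gamma>)"

definition conic_inside :: "point set \<Rightarrow> point set \<Rightarrow> point set" where
  "conic_inside \<gamma> \<Phi> = (\<Union>F\<in>\<Phi>. connected_component_set (- \<gamma>) F)"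

(* The library notion "arc" is an injective path, so the two end points are distinct. The end
   points belong to the arc. *)
definition is_infertile_arc :: "point set \<Rightarrow> point set \<Rightarrow> point set \<Rightarrow> point set \<Rightarrow> bool" where
  "is_infertile_arc \<Gamma> K \<gamma> \<Phi> \<longleftrightarrow>
     (\<exists>g. arc g \<and> path_image g = \<Gamma> \<and> \<Gamma> \<subseteq> K \<and> pathstart g \<in> \<gamma> \<and> pathfinish g \<in> \<gamma> \<and>
        \<Gamma> - {pathstart g, pathfinish g} \<subseteq> conic_inside \<gamma> \<Phi>)"

definition meet_in_two_points :: "point set \<Rightarrow> point set \<Rightarrow> bool" where
  "meet_in_two_points S K \<longleftrightarrow> (\<exists>X Y. X \<noteq> Y \<and> S \<inter> K = {X, Y})"

end

theory Submission
  imports Defs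
begin

text \<open>
  Take \<open>D\<close> as origin and write \<open>o\<close>, \<open>r\<close> for centre and radius of \<open>\<C>\<close>, \<open>o'\<close>, \<open>r'\<close> for those of \<open>\<C>\<^sub>D\<close>,
  \<open>k = |o|\<^sup>2 - r\<^sup>2\<close> and \<open>k' = |o'|\<^sup>2 - r'\<^sup>2\<close> for the powers of \<open>D\<close>. A point \<open>x\<close> lies on the perpendicular
  at \<open>v\<close> exactly when \<open>x \<bullet> v = v \<bullet> v\<close>, so a triangle inscribed in \<open>\<C>\<close> and its negative-pedal triangle
  are linked by six such equations.

  \<^bold>\<open>The porism.\<close> Start at \<open>a\<close> on \<open>\<C>\<close>, cut the perpendicular at \<open>a\<close> with \<open>\<C>\<^sub>D\<close>, pass to the two new feet \<open>b\<close>, \<open>c\<close>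
  on \<open>\<C>\<close> and intersect the perpendiculars there. In coordinates along \<open>a\<close> the power of the resulting
  vertex with respect to \<open>\<C>\<^sub>D\<close> is, up to nonzero factors, a polynomial in \<open>k\<close>, \<open>k'\<close> and the inner products of
  \<open>o\<close> and \<open>o'\<close> only (\<open>closing_identity_scalar\<close>); \<open>a\<close> has disappeared. Hence the construction closes for every \<open>a\<close> as
  soon as it closes once, and it does so for the given triangle (\<open>poncelet_closing\<close>).

  \<^bold>\<open>The i-conic.\<close> Every conic with focus \<open>D\<close> has an equation \<open>\<rho> |x| = |w \<bullet> x + \<kappa>|\<close>, its inside is given by \<open><\<close>
  (\<open>conic_focal_form\<close>), and the line \<open>n \<bullet> x = 1\<close> is tangent to it, possibly at infinity, only if \<open>|w + \<kappa> n| = \<rho>\<close>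
  (\<open>touching_line_dual\<close>, \<open>asymptote_dual\<close>): the reciprocal of the conic is a circle. The side of \<open>\<T>\<close> opposite
  to the vertex \<open>v\<close> is the polar of \<open>(2 o - v') / k\<close>, where \<open>v'\<close> is the corresponding vertex of \<open>\<T>\<^sub>D\<close>. So the
  reciprocal circle of the i-conic is homothetic to \<open>\<C>\<^sub>D\<close>, and the i-conic has the equation
  \<open>r' |x| = |(2 o - o') \<bullet> x - k|\<close> (\<open>i_conic_equation\<close>). On \<open>\<C>\<close> the right-hand side equals \<open>| |x|\<^sup>2 - o' \<bullet> x |\<close>, and comparing it
  with \<open>r' |x|\<close> means comparing the distance from \<open>o'\<close> to the perpendicular at \<open>x\<close> with \<open>r'\<close>. Therefore the
  perpendicular fails to be a secant of \<open>\<C>\<^sub>D\<close> exactly when \<open>x\<close> is on or inside the i-conic.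

  \<^bold>\<open>No isolated contact.\<close> It remains to see that such an \<open>x\<close> lies on an arc whose interior is inside the conic. The only
  obstacle is a point where \<open>\<C>\<close> touches the i-conic from outside. The closing condition forbids it: at
  every double zero of the equation of the conic along \<open>\<C>\<close> the second-order term is strictly positive
  (\<open>double_zero_scalar\<close>, \<open>conic_form_one_sided\<close>).
\<close>

section \<open>Algebra of the closing condition\<close>

text \<open>The powers \<open>k\<close>, \<open>k'\<close> of the origin and the inner products \<open>u\<close>, \<open>v\<close>, \<open>w\<close> of the two centres (\<open>|o|\<^sup>2\<close>, \<open>o \<bullet> o'\<close>,
  \<open>|o'|\<^sup>2\<close>) are the arguments. The vanishing of the expression is the relation \<open>(r'\<^sup>2 - |o'|\<^sup>2) (r'\<^sup>2 - |o' - 2 o|\<^sup>2) = - 4 k r'\<^sup>2\<close>, the analogue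
  of the Chapple-Euler relation for the conic with foci \<open>0\<close>, \<open>2 o\<close> and pedal circle \<open>\<C>\<close>.\<close>

definition closure_defect :: "real \<Rightarrow> real \<Rightarrow> real \<Rightarrow> real \<Rightarrow> real \<Rightarrow> real" where
  "closure_defect k k' u v w = 4 * k * w - k' * (4 * v - 4 * (u - k) - k')"

text \<open>In the scalar lemmas the point \<open>a\<close> is \<open>(1, 0)\<close>, so that \<open>p\<close>, \<open>q\<close> being the coordinates of the centre,
  \<open>a\<close> lies on the circle with power \<open>k\<close> exactly when \<open>k = 2 p - 1\<close>. Both \<open>a\<close> and the other foot \<open>(c1, c2)\<close> of a perpendicular through \<open>(1, y)\<close> lie on
  the line \<open>x1 + s * x2 = 1\<close>, which is the polar of \<open>(2 o - (1, y)) / k\<close> in the unit circle; the parameter \<open>s\<close> makes the foot rational.\<close>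

lemma second_point_scalar:
  fixes p q y c1 c2 k s :: real
  assumes k: "k = 2 * p - 1" "k \<noteq> 0" and s: "s = (2 * q - y) / k"
    and C: "c1\<^sup>2 + c2\<^sup>2 - 2 * (p * c1 + q * c2) + k = 0"
    and B: "c1 + y * c2 = c1\<^sup>2 + c2\<^sup>2"
    and ne: "\<not> (c1 = 1 \<and> c2 = 0)"
  shows "c1 = (1 - s * y) / (1 + s\<^sup>2)" "c2 = (y + s) / (1 + s\<^sup>2)" "y + s \<noteq> 0"
proof -
  have pos: "1 + s\<^sup>2 > 0" by (simp add: add_pos_nonneg)
  have ks: "k * s = 2 * q - y" using s k by simp
  have "k * (c1 - (1 - s * c2)) = 0"
    using B C ks k(1) by algebra
  then have c1: "c1 = 1 - s * c2" using k by simp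
  have "c2 * ((1 + s\<^sup>2) * c2 - (y + s)) = 0"
    using B unfolding c1 by algebra
  moreover have c2: "c2 \<noteq> 0" using c1 ne by auto
  ultimately have *: "(1 + s\<^sup>2) * c2 = y + s" by simp
  then show 2: "c2 = (y + s) / (1 + s\<^sup>2)" using pos by (simp add: field_simps)
  show "y + s \<noteq> 0" using * c2 pos by (metis less_irrefl mult_eq_0_iff)
  have "(1 + s\<^sup>2) * c1 = 1 - s * y" using * c1 by algebra
  then show "c1 = (1 - s * y) / (1 + s\<^sup>2)" using pos by (simp add: field_simps)
qed

text \<open>The heart of the porism. \<open>N1 / E\<close> and \<open>N2 / E\<close> are the coordinates of the closing vertex, hence the left-hand side is
  \<open>E\<^sup>2\<close> times its power with respect to the second circle. The factors \<open>y + s\<close> and \<open>z + t\<close> vanish only when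
  a new foot coincides with \<open>a\<close>. The second identity shows that under the closing condition \<open>E = 0\<close> would
  force two squares to vanish; this is how a closing vertex at infinity is excluded below.\<close>

lemma closing_identity_scalar:
  fixes p q p' q' y z k k' s t E N1 N2 :: real
  assumes k: "k = 2 * p - 1" 
    and s: "y = 2 * q - k * s" and t: "z = 2 * q - k * t"
    and q': "y + z = 2 * q'" and k': "y * z = 1 - 2 * p' + k'"
    and E: "E = k - 1 - y * z + k * (s * t)"
    and N1: "N1 = k - 1 - k * (y * z) - 4 * q\<^sup>2 + k\<^sup>2 * (s * t)"
    and N2: "N2 = k * (y + z) - 2 * q + k * (s + t) - 2 * q * (y * z)"
  shows "N1\<^sup>2 + N2\<^sup>2 - 2 * (p' * N1 + q' * N2) * E + k' * E\<^sup>2 =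
     (y + s) * (z + t) * closure_defect k k' (p * p + q * q) (p * p' + q * q') (p' * p' + q' * q')" (is ?A)
   "closure_defect k k' (p * p + q * q) (p * p' + q * q') (p' * p' + q' * q') =
     k * ((2 * p' - k')\<^sup>2 + 4 * q'\<^sup>2 + k' * E)" (is ?B)
proof -
  \<comment> \<open>the closing defect is affine in \<open>p'\<close> because its two quadratic terms cancel; the identities \<open>a\<close>, \<open>b\<close>, \<open>c\<close> compare coefficients\<close>
  define M where "M = 2 * q * (y + z) - (k - 1)\<^sup>2 - 4 * q\<^sup>2 - (y * z - 1)"
  have p: "2 * p = k + 1" using k by simp
  have k'2: "k' = y * z - 1 + 2 * p'" using k' by simp
  have a: "N1\<^sup>2 + N2\<^sup>2 - (y + z) * N2 * E + (y * z - 1) * E\<^sup>2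
      = k * ((y + s) * (z + t)) * ((y + z)\<^sup>2 + (y * z - 1) * (E + (y * z - 1)))"
    unfolding E N1 N2 s t by (simp add: algebra_simps power2_eq_square)
  have b: "E - N1 = k * ((y + s) * (z + t))"
    unfolding E N1 s t by (simp add: algebra_simps power2_eq_square)
  have c: "M = - k * (E + (y * z - 1))"
    unfolding E M_def s t by (simp add: algebra_simps power2_eq_square)
  have "4 * (p * p' + q * q') - 4 * ((p * p + q * q) - k) - k' = 2 * k * p' + M"
    unfolding k'2 M_def using p q' by algebra
  then have d: "closure_defect k k' (p * p + q * q) (p * p' + q * q') (p' * p' + q' * q')
      = 4 * k * p'\<^sup>2 + k * (y + z)\<^sup>2 - k' * (2 * k * p' + M)"
    unfolding closure_defect_def q' by algebra
  show ?B unfolding d c unfolding k'2 using q' by algebra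
  show ?A unfolding d c unfolding k'2 using a b q' by algebra
qed

text \<open>Cramer's rule, with the common factor \<open>s - t\<close> of determinant and numerators removed. Parallel lines are included, because nothing is divided by \<open>E\<close>.\<close>

lemma closing_vertex_scalar:
  fixes p q y z k s t E N1 N2 x1 x2 :: real
  assumes s: "y = 2 * q - k * s" and t: "z = 2 * q - k * t" and ne: "y \<noteq> z" "k \<noteq> 0"
    and E: "E = k - 1 - y * z + k * (s * t)"
    and N1: "N1 = k - 1 - k * (y * z) - 4 * q\<^sup>2 + k\<^sup>2 * (s * t)"
    and N2: "N2 = k * (y + z) - 2 * q + k * (s + t) - 2 * q * (y * z)"
    and L1: "(1 - s * y) * x1 + (y + s) * x2 = 1 + y\<^sup>2"
    and L2: "(1 - t * z) * x1 + (z + t) * x2 = 1 + z\<^sup>2"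
  shows "x1 * E = N1" "x2 * E = N2"
proof -
  have st: "s - t \<noteq> 0" using s t ne by auto
  have "(1 - s * y) * (z + t) - (1 - t * z) * (y + s) = (s - t) * E"
    unfolding E s t by (simp add: algebra_simps power2_eq_square)
  then have "x1 * ((s - t) * E) = (1 + y\<^sup>2) * (z + t) - (1 + z\<^sup>2) * (y + s)"
            "x2 * ((s - t) * E) = (1 + z\<^sup>2) * (1 - s * y) - (1 + y\<^sup>2) * (1 - t * z)"
    using L1 L2 by algebra+
  moreover have "(1 + y\<^sup>2) * (z + t) - (1 + z\<^sup>2) * (y + s) = (s - t) * N1"
    unfolding N1 s t by (simp add: algebra_simps power2_eq_square)
  moreover have "(1 + z\<^sup>2) * (1 - s * y) - (1 + y\<^sup>2) * (1 - t * z) = (s - t) * N2"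
    unfolding N2 s t by (simp add: algebra_simps power2_eq_square)
  ultimately have "(s - t) * (x1 * E) = (s - t) * N1" "(s - t) * (x2 * E) = (s - t) * N2"
    by (simp_all add: algebra_simps)
  with st show "x1 * E = N1" "x2 * E = N2" by simp_all
qed

text \<open>Here \<open>q'\<close> is the ordinate of the point where the perpendicular at \<open>(1, 0)\<close> touches the second circle. If the equation of
  the conic has a double zero at \<open>(1, 0)\<close> along the first circle, the direction from \<open>(1, 0)\<close> to the centre is, up to sign, that from the origin to the
  point of contact \<open>(1, q')\<close>, reflected in the first axis: \<open>q = - \<mu> q'\<close>. The closing condition then determines the remaining
  parameter, \<open>4 l \<mu> = - (1 + q'\<^sup>2) k\<close>, and the second-order coefficient collapses to \<open>3 (\<mu> l)\<^sup>2\<close>.\<close>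

lemma double_zero_scalar:
  fixes p q p' q' k k' R l0 :: real
  assumes k: "k = 2 * p - 1" "k \<noteq> 0" and k': "k' = p'\<^sup>2 + q'\<^sup>2 - R" and R: "R > 0"
    and cl: "closure_defect k k' (p * p + q * q) (p * p' + q * q') (p' * p' + q' * q') = 0"
    and l0: "l0 = 1 - p'" and zero: "l0\<^sup>2 = R"
    and g: "(l0 * (2 * p - p') - R) * q + l0 * (2 * q - q') * (1 - p) = 0"
  shows "(l0 * (2 * p - p') - R) * (p - 1) + l0 * (2 * q - q') * q
     + ((2 * p - p') * q + (2 * q - q') * (1 - p))\<^sup>2 - R * (q\<^sup>2 + (1 - p)\<^sup>2) > 0" (is "?Q > 0")
proof -
  define \<mu> where "\<mu> = p - 1"
  define l where "l = p' - 1"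
  have l0: "l0 = - l" using l0 l_def by simp
  have R2: "R = l\<^sup>2" using zero l0 by simp
  have l: "l \<noteq> 0" using R R2 by auto
  have ps: "p = 1 + \<mu>" "p' = 1 + l" using \<mu>_def l_def by auto
  have "l * (q + \<mu> * q') = 0" using g unfolding l0 R2 ps by algebra
  then have q: "q = - \<mu> * q'" using l by simp
  have k2: "k = 1 + 2 * \<mu>" using k ps by simp
  have k'2: "k' = 1 + q'\<^sup>2 + 2 * l" unfolding k' R2 ps by (simp add: power2_eq_square algebra_simps)
  have S: "1 + q'\<^sup>2 > 0" by (simp add: add_pos_nonneg)
  have "closure_defect k k' (p * p + q * q) (p * p' + q * q') (p' * p' + q' * q')
     = k * ((1 + q'\<^sup>2) * (4 * l * \<mu> + (1 + q'\<^sup>2) * k))"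
    unfolding closure_defect_def k'2 k2 q ps by algebra
  then have "4 * l * \<mu> + (1 + q'\<^sup>2) * k = 0" using cl k(2) S by simp
  then have *: "4 * l * \<mu> = - (1 + q'\<^sup>2) * k" by algebra
  have "\<mu> \<noteq> 0" using * S k by auto
  have "?Q = - \<mu>\<^sup>2 * l\<^sup>2 - \<mu> * l * ((1 + q'\<^sup>2) * k)"
    unfolding l0 R2 q ps k2 by algebra
  also have "\<dots> = 3 * (\<mu> * l)\<^sup>2" using * by algebra
  finally show ?thesis using l \<open>\<mu> \<noteq> 0\<close> by simp
qed

section \<open>Coordinates along a vector and Poncelet closing\<close>

definition rot90 :: "real^2 \<Rightarrow> real^2" where
  "rot90 x = vector [- x $ 2, x $ 1]"

lemma inner_real2: "x \<bullet> y = x $ 1 * y $ 1 + x $ 2 * y $ 2" for x y :: "real^2"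
  by (simp add: inner_vec_def sum_2)

lemma rot90_nth [simp]: "rot90 x $ 1 = - x $ 2" "rot90 x $ 2 = x $ 1"
  by (simp_all add: rot90_def)

lemma inner_rot90:
  "rot90 (rot90 x) = - x"
  "rot90 x \<bullet> rot90 y = x \<bullet> y" "rot90 x \<bullet> y = - (x \<bullet> rot90 y)" "rot90 x \<bullet> x = 0" "x \<bullet> rot90 x = 0"
  by (simp_all add: inner_real2 vec_eq_iff forall_2)

text \<open>The Lagrange identity of the plane: \<open>a\<close> and its quarter turn form an orthogonal basis of vectors of equal length.\<close>

lemma frame_inner: "(a \<bullet> a) * (x \<bullet> y) = (x \<bullet> a) * (y \<bullet> a) + (x \<bullet> rot90 a) * (y \<bullet> rot90 a)"
  for a :: "real^2"
  by (simp add: inner_real2 algebra_simps)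

text \<open>Coordinates in the basis \<open>a\<close>, \<open>rot90 a\<close>. They are scaled so that \<open>a\<close> becomes \<open>(1, 0)\<close>, and all inner products are
  divided by \<open>|a|\<^sup>2\<close>; this reduces statements about an arbitrary \<open>a\<close> to the scalar lemmas.\<close>

definition crd1 :: "real^2 \<Rightarrow> real^2 \<Rightarrow> real" where "crd1 a x = (x \<bullet> a) / (a \<bullet> a)"
definition crd2 :: "real^2 \<Rightarrow> real^2 \<Rightarrow> real" where "crd2 a x = (x \<bullet> rot90 a) / (a \<bullet> a)"

lemma inner_crd: 
  assumes "a \<noteq> 0" 
  shows "x \<bullet> y = (a \<bullet> a) * (crd1 a x * crd1 a y + crd2 a x * crd2 a y)"
proof -
  have "a \<bullet> a \<noteq> 0" using assms by simp
  then show ?thesis using frame_inner[of a x y]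
    by (simp add: crd1_def crd2_def field_simps)
qed

lemma crd_simps: 
  assumes "a \<noteq> 0"
  shows "crd1 a a = 1" "crd2 a a = 0" 
    "crd1 a (x + y) = crd1 a x + crd1 a y" "crd2 a (x + y) = crd2 a x + crd2 a y"
    "crd1 a (x - y) = crd1 a x - crd1 a y" "crd2 a (x - y) = crd2 a x - crd2 a y"
    "crd1 a (r *\<^sub>R x) = r * crd1 a x" "crd2 a (r *\<^sub>R x) = r * crd2 a x"
    "crd1 a (rot90 x) = - crd2 a x" "crd2 a (rot90 x) = crd1 a x"
  using assms by (simp_all add: crd1_def crd2_def inner_rot90 inner_simps add_divide_distrib diff_divide_distrib)

lemma crd_eqI:
  assumes "a \<noteq> 0" "crd1 a x = crd1 a y" "crd2 a x = crd2 a y"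
  shows "x = y"
proof -
  have "(x - y) \<bullet> (x - y) = 0"
    using inner_crd[OF assms(1), of "x - y" "x - y"] assms by (simp add: crd_simps)
  then show ?thesis by simp
qed

text \<open>The closing condition for two circles with centres \<open>u\<close>, \<open>u'\<close> and powers \<open>k\<close>, \<open>k'\<close> of the origin.\<close>

definition poristic :: "real \<Rightarrow> real \<Rightarrow> real^2 \<Rightarrow> real^2 \<Rightarrow> bool" where
  "poristic k k' u u' \<longleftrightarrow> closure_defect k k' (u \<bullet> u) (u \<bullet> u') (u' \<bullet> u') = 0"

text \<open>The closing condition is homogeneous of degree two, hence invariant under the rescaling of coordinates.\<close>

lemma poristic_crd:
  assumes "a \<noteq> 0"
  shows "poristic k k' u u' \<longleftrightarrow> 
    closure_defect (k / (a \<bullet> a)) (k' / (a \<bullet> a)) (crd1 a u * crd1 a u + crd2 a u * crd2 a u)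
       (crd1 a u * crd1 a u' + crd2 a u * crd2 a u') (crd1 a u' * crd1 a u' + crd2 a u' * crd2 a u') = 0"
    (is "_ \<longleftrightarrow> closure_defect _ _ ?A ?B ?C = 0")
proof -
  define n where "n = a \<bullet> a"
  have n: "n \<noteq> 0" using assms by (simp add: n_def)
  have "closure_defect k k' (n * ?A) (n * ?B) (n * ?C) = n\<^sup>2 * closure_defect (k / n) (k' / n) ?A ?B ?C"
    using n by (simp add: closure_defect_def field_simps power2_eq_square)
  then show ?thesis
    unfolding poristic_def inner_crd[OF assms, of u] inner_crd[OF assms, of u'] n_def[symmetric]
    using n by simp
qed

text \<open>The equivalence is used in both directions. For the given triangle the closing vertex is known to lie on the second circle,
  which yields the closing condition; for an arbitrary starting point the condition puts the closing vertex on the circle.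
  The second conclusion guarantees in the latter case that the closing vertex exists. If the numerator \<open>E\<close> of the determinant
  vanished, the two points on the perpendicular at \<open>a\<close> would have ordinates with sum \<open>0\<close> and product \<open>1\<close>, which is impossible over the reals.\<close>

lemma poncelet_closing:
  fixes a b c b' c' u u' :: "real^2" and k k' :: real
  assumes k: "k \<noteq> 0" and a0: "a \<noteq> 0"
    and a: "a \<bullet> a - 2 * (u \<bullet> a) + k = 0" and b: "b \<bullet> b - 2 * (u \<bullet> b) + k = 0"
    and c: "c \<bullet> c - 2 * (u \<bullet> c) + k = 0"
    and ab': "b' \<bullet> a = a \<bullet> a" and ac': "c' \<bullet> a = a \<bullet> a" and ne': "b' \<noteq> c'"
    and b': "b' \<bullet> b' - 2 * (u' \<bullet> b') + k' = 0" and c': "c' \<bullet> c' - 2 * (u' \<bullet> c') + k' = 0"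
    and cb': "b' \<bullet> c = c \<bullet> c" and bc': "c' \<bullet> b = b \<bullet> b" and ne: "c \<noteq> a" "b \<noteq> a"
  shows "x \<bullet> b = b \<bullet> b \<Longrightarrow> x \<bullet> c = c \<bullet> c \<Longrightarrow> 
      x \<bullet> x - 2 * (u' \<bullet> x) + k' = 0 \<longleftrightarrow> poristic k k' u u'"
    and "poristic k k' u u' \<Longrightarrow> b \<bullet> rot90 c \<noteq> 0"
proof -
  define n where "n = a \<bullet> a"
  have n: "n \<noteq> 0" using a0 by (simp add: n_def)
  have inn: "v \<bullet> w = n * (crd1 a v * crd1 a w + crd2 a v * crd2 a w)" for v w
    unfolding n_def by (rule inner_crd[OF a0])
  note crds = crd_simps(1,2)[OF a0]
  define p q p' q' \<kappa> \<kappa>' y z where pq: "p = crd1 a u" "q = crd2 a u" "p' = crd1 a u'" "q' = crd2 a u'"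
     "\<kappa> = k / n" "\<kappa>' = k' / n" "y = crd2 a b'" "z = crd2 a c'"
  have kk: "k = n * \<kappa>" "k' = n * \<kappa>'" using n pq by auto
  have \<kappa>0: "\<kappa> \<noteq> 0" using k kk by auto
  have b'1: "crd1 a b' = 1" and c'1: "crd1 a c' = 1"
    using ab' ac' n by (simp_all add: crd1_def n_def)
  have yz: "y \<noteq> z" using crd_eqI[OF a0, of b' c'] ne' b'1 c'1 pq by auto
  define s t where st: "s = (2 * q - y) / \<kappa>" "t = (2 * q - z) / \<kappa>"
  have ys: "y = 2 * q - \<kappa> * s" and zt: "z = 2 * q - \<kappa> * t" using st \<kappa>0 by simp_all
  have cancel: "n * X = 0 \<Longrightarrow> X = 0" for X using n by simp
  have \<kappa>: "\<kappa> = 2 * p - 1" 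
    using a cancel[of "1 - 2 * p + \<kappa>"] unfolding inn kk by (simp add: crds pq(1,2) algebra_simps)
  have y2: "1 + y\<^sup>2 - 2 * (p' + q' * y) + \<kappa>' = 0"
    by (rule cancel) (use b' in \<open>unfold inn kk, simp add: b'1 pq(3,4,7) power2_eq_square algebra_simps\<close>)
  have z2: "1 + z\<^sup>2 - 2 * (p' + q' * z) + \<kappa>' = 0"
    by (rule cancel) (use c' in \<open>unfold inn kk, simp add: c'1 pq(3,4,8) power2_eq_square algebra_simps\<close>)
  have "(y - z) * (y + z - 2 * q') = 0" using y2 z2 by algebra
  then have q': "y + z = 2 * q'" using yz by simp
  then have k': "y * z = 1 - 2 * p' + \<kappa>'" using y2 by algebra
  define c1 c2 b1 b2 where cb: "c1 = crd1 a c" "c2 = crd2 a c" "b1 = crd1 a b" "b2 = crd2 a b"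
  have C: "c1\<^sup>2 + c2\<^sup>2 - 2 * (p * c1 + q * c2) + \<kappa> = 0"
    by (rule cancel) (use c in \<open>unfold inn kk, simp add: cb pq(1,2) power2_eq_square algebra_simps\<close>)
  have B: "b1\<^sup>2 + b2\<^sup>2 - 2 * (p * b1 + q * b2) + \<kappa> = 0"
    by (rule cancel) (use b in \<open>unfold inn kk, simp add: cb pq(1,2) power2_eq_square algebra_simps\<close>)
  have C': "c1 + y * c2 = c1\<^sup>2 + c2\<^sup>2"
    using cb' n unfolding inn by (simp add: b'1 cb pq(7) power2_eq_square)
  have B': "b1 + z * b2 = b1\<^sup>2 + b2\<^sup>2"
    using bc' n unfolding inn by (simp add: c'1 cb pq(8) power2_eq_square)
  have neC: "\<not> (c1 = 1 \<and> c2 = 0)" using crd_eqI[OF a0, of c a] ne by (auto simp: cb crds)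
  have neB: "\<not> (b1 = 1 \<and> b2 = 0)" using crd_eqI[OF a0, of b a] ne by (auto simp: cb crds)
  note cs = second_point_scalar[OF \<kappa> \<kappa>0 st(1) C C' neC]
  note bs = second_point_scalar[OF \<kappa> \<kappa>0 st(2) B B' neB]
  have pos: "1 + s\<^sup>2 > 0" "1 + t\<^sup>2 > 0" by (simp_all add: add_pos_nonneg)
  have cbs: "(1 + s\<^sup>2) * c1 = 1 - s * y" "(1 + s\<^sup>2) * c2 = y + s"
    "(1 + t\<^sup>2) * b1 = 1 - t * z" "(1 + t\<^sup>2) * b2 = z + t"
    using cs(1,2) bs(1,2) pos by simp_all
  define E N1 N2 where E: "E = \<kappa> - 1 - y * z + \<kappa> * (s * t)"
    and N1: "N1 = \<kappa> - 1 - \<kappa> * (y * z) - 4 * q\<^sup>2 + \<kappa>\<^sup>2 * (s * t)"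
    and N2: "N2 = \<kappa> * (y + z) - 2 * q + \<kappa> * (s + t) - 2 * q * (y * z)"
  note id = closing_identity_scalar[OF \<kappa> ys zt q' k' E N1 N2]
  have por: "poristic k k' u u' \<longleftrightarrow> 
    closure_defect \<kappa> \<kappa>' (p * p + q * q) (p * p' + q * q') (p' * p' + q' * q') = 0"
    unfolding poristic_crd[OF a0] pq n_def ..
  have E0: "E \<noteq> 0" if "poristic k k' u u'"
  proof
    assume "E = 0"
    then have "(2 * p' - \<kappa>')\<^sup>2 + 4 * q'\<^sup>2 = 0"
      using id(2) that por \<kappa>0 by simp
    then have "2 * p' = \<kappa>'" "q' = 0"
      by (auto simp: add_nonneg_eq_0_iff)
    then have "z = - y" "y * z = 1" using q' k' by simp_all
    then have "y\<^sup>2 + 1 = 0" by (simp add: power2_eq_square)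
    then show False by (metis add.commute one_neq_zero zero_neq_one add_nonneg_eq_0_iff zero_le_one zero_le_power2)
  qed
  { assume xb: "x \<bullet> b = b \<bullet> b" and xc: "x \<bullet> c = c \<bullet> c"
    define x1 x2 where x: "x1 = crd1 a x" "x2 = crd2 a x"
    have "x1 * c1 + x2 * c2 = c1 + y * c2" "x1 * b1 + x2 * b2 = b1 + z * b2"
      using xb xc n unfolding inn C' B' by (simp_all add: x cb power2_eq_square)
    then have "(1 - s * y) * x1 + (y + s) * x2 = (1 - s * y) + y * (y + s)"
      "(1 - t * z) * x1 + (z + t) * x2 = (1 - t * z) + z * (z + t)"
      unfolding cbs[symmetric] by algebra+
    then have "(1 - s * y) * x1 + (y + s) * x2 = 1 + y\<^sup>2"
      "(1 - t * z) * x1 + (z + t) * x2 = 1 + z\<^sup>2"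
      by (simp_all add: algebra_simps power2_eq_square)
    note xN = closing_vertex_scalar[OF ys zt yz \<kappa>0 E N1 N2 this]
    have "E\<^sup>2 * (x1\<^sup>2 + x2\<^sup>2 - 2 * (p' * x1 + q' * x2) + \<kappa>') = (y + s) * (z + t) *
         closure_defect \<kappa> \<kappa>' (p * p + q * q) (p * p' + q * q') (p' * p' + q' * q')"
      unfolding id(1)[symmetric] xN[symmetric] by (simp add: algebra_simps power2_eq_square)
    moreover have "x \<bullet> x - 2 * (u' \<bullet> x) + k' = n * (x1\<^sup>2 + x2\<^sup>2 - 2 * (p' * x1 + q' * x2) + \<kappa>')"
      unfolding inn kk by (simp add: x pq(3,4) power2_eq_square algebra_simps)
    ultimately show "x \<bullet> x - 2 * (u' \<bullet> x) + k' = 0 \<longleftrightarrow> poristic k k' u u'"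
      using por E0 n cs(3) bs(3) by auto }
  assume por1: "poristic k k' u u'"
  have "b \<bullet> rot90 c = n * (b2 * c1 - b1 * c2)"
    unfolding inn by (simp add: crd_simps[OF a0] cb algebra_simps)
  moreover have "(1 + s\<^sup>2) * (1 + t\<^sup>2) * (b2 * c1 - b1 * c2) =
      (1 - s * y) * (z + t) - (1 - t * z) * (y + s)"
    unfolding cbs[symmetric] by algebra
  moreover have "(1 - s * y) * (z + t) - (1 - t * z) * (y + s) = (s - t) * E"
    unfolding E ys zt by (simp add: algebra_simps power2_eq_square)
  moreover have "s \<noteq> t" using ys zt yz by auto
  ultimately show "b \<bullet> rot90 c \<noteq> 0" using n E0[OF por1] pos by auto
qed

text \<open>With \<open>x\<close> running along the circle with centre \<open>u\<close> through \<open>a\<close>, the vector \<open>g\<close> is half the gradient of \<open>(m \<bullet> x - k)\<^sup>2 - R |x|\<^sup>2\<close> at \<open>a\<close>,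
  and \<open>v\<close> is tangent to the circle. The condition \<open>g \<bullet> v = 0\<close> thus says that the zero at \<open>a\<close> is at least double, and the conclusion
  concerns the next coefficient, in which \<open>u - a\<close> accounts for the curvature of the circle.\<close>

lemma double_zero_positive:
  fixes a u u' :: "real^2" and k k' R :: real
  assumes k: "k \<noteq> 0" and a0: "a \<noteq> 0" and R: "R > 0" "k' = u' \<bullet> u' - R"
    and a: "a \<bullet> a - 2 * (u \<bullet> a) + k = 0" and por: "poristic k k' u u'"
    and m: "m = 2 *\<^sub>R u - u'" and l0: "l0 = m \<bullet> a - k" and zero: "l0\<^sup>2 = R * (a \<bullet> a)"
    and g: "g = l0 *\<^sub>R m - R *\<^sub>R a" and v: "v = rot90 (a - u)" and gv: "g \<bullet> v = 0"
  shows "g \<bullet> (u - a) + (m \<bullet> v)\<^sup>2 - R * (v \<bullet> v) > 0"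
proof -
  define n where "n = a \<bullet> a"
  have n: "n > 0" using a0 by (simp add: n_def)
  have inn: "v \<bullet> w = n * (crd1 a v * crd1 a w + crd2 a v * crd2 a w)" for v w
    unfolding n_def by (rule inner_crd[OF a0])
  note crds = crd_simps[OF a0]
  define p q p' q' \<kappa> \<kappa>' r l where pq: "p = crd1 a u" "q = crd2 a u" "p' = crd1 a u'" "q' = crd2 a u'"
     "\<kappa> = k / n" "\<kappa>' = k' / n" "r = R / n" "l = l0 / n"
  have kk: "k = n * \<kappa>" "k' = n * \<kappa>'" "R = n * r" "l0 = n * l" using n pq by auto
  have \<kappa>0: "\<kappa> \<noteq> 0" using k kk by auto
  have cancel: "n * X = 0 \<Longrightarrow> X = 0" for X using n by simp
  have \<kappa>: "\<kappa> = 2 * p - 1" 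
    using a cancel[of "1 - 2 * p + \<kappa>"] unfolding inn kk by (simp add: crds pq(1,2) algebra_simps)
  have "n * (p'\<^sup>2 + q'\<^sup>2 - r - \<kappa>') = 0"
    using R(2) unfolding inn[of u' u'] kk by (simp add: pq(3,4) algebra_simps power2_eq_square)
  then have \<kappa>': "\<kappa>' = p'\<^sup>2 + q'\<^sup>2 - r" using n by simp
  have r: "r > 0" using R n pq by simp
  have cl: "closure_defect \<kappa> \<kappa>' (p * p + q * q) (p * p' + q * q') (p' * p' + q' * q') = 0"
    using por unfolding poristic_crd[OF a0] pq n_def .
  have mc: "crd1 a m = 2 * p - p'" "crd2 a m = 2 * q - q'" unfolding m by (simp_all add: crds pq)
  have "n * (l - (2 * p - p' - \<kappa>)) = 0"
    using l0 unfolding inn kk mc by (simp add: crds algebra_simps)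
  then have l: "l = 1 - p'" using n \<kappa> by simp
  have "n * (n * (l\<^sup>2 - r)) = 0"
    using zero unfolding inn kk by (simp add: crds algebra_simps power2_eq_square)
  then have lr: "l\<^sup>2 = r" using n by simp
  have gc: "crd1 a g = n * (l * (2 * p - p') - r)" "crd2 a g = n * (l * (2 * q - q'))" 
    unfolding g by (simp_all add: crds mc kk algebra_simps)
  have vc: "crd1 a v = q" "crd2 a v = 1 - p" unfolding v by (simp_all add: crds pq)
  have wc: "crd1 a (u - a) = p - 1" "crd2 a (u - a) = q" by (simp_all add: crds pq)
  have "n * (n * ((l * (2 * p - p') - r) * q + l * (2 * q - q') * (1 - p))) = 0"
    using gv unfolding inn gc vc by (simp add: algebra_simps)
  then have gz: "(l * (2 * p - p') - r) * q + l * (2 * q - q') * (1 - p) = 0" using n by simp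
  note pos = double_zero_scalar[OF \<kappa> \<kappa>0 \<kappa>' r cl l lr gz]
  have "g \<bullet> (u - a) + (m \<bullet> v)\<^sup>2 - R * (v \<bullet> v) = n\<^sup>2 * ((l * (2 * p - p') - r) * (p - 1) + l * (2 * q - q') * q
     + ((2 * p - p') * q + (2 * q - q') * (1 - p))\<^sup>2 - r * (q\<^sup>2 + (1 - p)\<^sup>2))"
    unfolding inn gc vc wc mc kk by algebra
  then show ?thesis using pos n by simp
qed

section \<open>Perpendicular lines, circles and their intersections\<close>

lemma eq_zero_if_orthogonal:
  assumes "y \<bullet> u = 0" "y \<bullet> v = 0" "u \<bullet> rot90 v \<noteq> 0"
  shows "y = 0"
proof -
  have "y $ 1 * (u \<bullet> rot90 v) = 0" "y $ 2 * (u \<bullet> rot90 v) = 0"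
    using assms(1,2) unfolding inner_real2 rot90_nth by algebra+
  then show ?thesis using assms(3) by (simp add: vec_eq_iff forall_2)
qed

lemma perp_line_iff: "X \<in> perp_line D V \<longleftrightarrow> (X - D) \<bullet> (V - D) = (V - D) \<bullet> (V - D)"
proof -
  have "X - V = (X - D) - (V - D)" by simp
  then show ?thesis
    unfolding perp_line_def orthogonal_def mem_Collect_eq by (simp only: inner_diff_left[of "X - D"] right_minus_eq)
qed

lemma sphere_iff:
  fixes X c D :: point
  assumes "r > 0"
  shows "X \<in> sphere c r \<longleftrightarrow>
    (X - D) \<bullet> (X - D) - 2 * ((c - D) \<bullet> (X - D)) + ((c - D) \<bullet> (c - D) - r\<^sup>2) = 0"
proof -
  have "X \<in> sphere c r \<longleftrightarrow> (norm (X - c))\<^sup>2 = r\<^sup>2"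
    using assms by (simp add: dist_norm norm_minus_commute)
  also have "(norm (X - c))\<^sup>2 = ((X - D) - (c - D)) \<bullet> ((X - D) - (c - D))"
    by (simp add: power2_norm_eq_inner)
  finally show ?thesis by (simp add: inner_diff_left inner_diff_right inner_commute algebra_simps)
qed

lemma diameter_circle_iff: "X \<in> diameter_circle Y D \<longleftrightarrow> (Y - D) \<bullet> (X - D) = (X - D) \<bullet> (X - D)"
proof -
  have m: "midpoint Y D = D + (1/2) *\<^sub>R (Y - D)"
    by (simp add: midpoint_def algebra_simps) (simp add: vec_eq_iff field_simps)
  have sq: "((1/2) *\<^sub>R y - z) \<bullet> ((1/2) *\<^sub>R y - z) = (y \<bullet> y) / 4 - y \<bullet> z + z \<bullet> z" for y z :: point
    by (simp add: inner_real2 field_simps)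
  have e: "midpoint Y D - X = (1/2) *\<^sub>R (Y - D) - (X - D)" by (simp add: m)
  have "X \<in> diameter_circle Y D \<longleftrightarrow> (norm (midpoint Y D - X))\<^sup>2 = (norm (Y - D) / 2)\<^sup>2"
    unfolding diameter_circle_def by (simp add: dist_norm)
  then show ?thesis
    unfolding e power_divide power2_norm_eq_inner sq by auto
qed

lemma affine_hull_eq_perp_line:
  assumes "V \<noteq> D" "X \<in> perp_line D V" "Y \<in> perp_line D V" "X \<noteq> Y"
  shows "affine hull {X, Y} = perp_line D V"
proof
  define v where "v = V - D"
  have v0: "v \<noteq> 0" using assms by (simp add: v_def)
  have p: "(Z - X) \<bullet> v = 0 \<longleftrightarrow> Z \<in> perp_line D V" for Z
    using assms(2) unfolding perp_line_iff by (auto simp: v_def[symmetric] inner_diff_left)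
  show "affine hull {X, Y} \<subseteq> perp_line D V"
  proof -
    have "X + t *\<^sub>R (Y - X) \<in> perp_line D V" for t
      using assms(3) p[of Y] p[of "X + t *\<^sub>R (Y - X)"] by simp
    then show ?thesis unfolding affine_hull_2_alt by blast
  qed
  show "perp_line D V \<subseteq> affine hull {X, Y}"
  proof
    fix Z assume Z: "Z \<in> perp_line D V"
    define t where "t = crd2 v (Z - X) / crd2 v (Y - X)"
    have 1: "crd1 v (Z - X) = 0" "crd1 v (Y - X) = 0"
      using p[of Z] p[of Y] Z assms(3) by (simp_all add: crd1_def)
    have "crd2 v (Y - X) \<noteq> 0"
      using crd_eqI[OF v0, of "Y - X" 0] 1 assms(4) by (auto simp: crd1_def crd2_def)
    then have "Z - X = t *\<^sub>R (Y - X)"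
      using 1 by (intro crd_eqI[OF v0]) (simp_all add: crd_simps(7,8)[OF v0] t_def)
    then have "Z = X + t *\<^sub>R (Y - X)" by (simp add: algebra_simps)
    then show "Z \<in> affine hull {X, Y}" unfolding affine_hull_2_alt by blast
  qed
qed

text \<open>A line determines the foot of the perpendicular from \<open>D\<close>. This is what excludes the degenerate positions of the construction,
  in which two of its lines would coincide.\<close>

lemma perp_line_foot_unique:
  assumes "V \<noteq> D" "W \<noteq> D" "X \<noteq> Y" "X \<in> perp_line D V" "Y \<in> perp_line D V"
    "X \<in> perp_line D W" "Y \<in> perp_line D W"
  shows "V = W"
proof -
  have eq: "perp_line D V = perp_line D W"
    using affine_hull_eq_perp_line[OF assms(1,4,5,3)] affine_hull_eq_perp_line[OF assms(2,6,7,3)] by simp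
  have "V \<in> perp_line D V" "W \<in> perp_line D W" by (simp_all add: perp_line_iff)
  then have "(V - D) \<bullet> (W - D) = (W - D) \<bullet> (W - D)" "(W - D) \<bullet> (V - D) = (V - D) \<bullet> (V - D)"
    using eq perp_line_iff by blast+
  then have "((V - D) - (W - D)) \<bullet> ((V - D) - (W - D)) = 0"
    by (simp only: inner_diff_left[of "V - D"] inner_diff_right[of _ "V - D"] inner_commute)
  then show ?thesis by simp
qed

lemma not_collinear_cross:
  fixes X Y Z :: point
  assumes "\<not> collinear {X, Y, Z}"
  shows "(X - Y) \<bullet> rot90 (X - Z) \<noteq> 0"
proof
  assume 0: "(X - Y) \<bullet> rot90 (X - Z) = 0"
  have "X - Z \<noteq> 0" using assms by (auto simp: insert_commute)
  note c = crd_simps[OF this] and I = crd_eqI[OF this]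
  define t where "t = crd1 (X - Z) (X - Y)"
  have "X - Y = t *\<^sub>R (X - Z)"
    by (rule I) (use 0 in \<open>simp_all add: c(1,2,7,8) t_def crd2_def inner_rot90\<close>)
  then have "Y = X + t *\<^sub>R (Z - X)" by (simp add: algebra_simps)
  then have "Y \<in> affine hull {X, Z}" unfolding affine_hull_2_alt by blast
  then have "collinear {X, Z, Y}" by (rule affine_hull_3_imp_collinear)
  then show False using assms by (simp add: insert_commute)
qed

lemma sphere_not_collinear:
  fixes X Y Z c :: point
  assumes "X \<in> sphere c r" "Y \<in> sphere c r" "Z \<in> sphere c r" "X \<noteq> Y" "Y \<noteq> Z" "Z \<noteq> X" 
  shows "\<not> collinear {X, Y, Z}"
proof
  assume "collinear {X, Y, Z}"
  then obtain t where t: "Y = t *\<^sub>R X + (1 - t) *\<^sub>R Z"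
    using assms(6) unfolding collinear_3_expand by auto
  define d where "d = X - Z"
  have "Z \<bullet> Z - 2 * (c \<bullet> Z) = X \<bullet> X - 2 * (c \<bullet> X)" "Y \<bullet> Y - 2 * (c \<bullet> Y) = Z \<bullet> Z - 2 * (c \<bullet> Z)"
    using assms(1-3) by (auto simp: dist_norm norm_eq_sqrt_inner inner_simps inner_commute algebra_simps dest!: arg_cong[of _ r "\<lambda>x. x\<^sup>2"])
  moreover have "X = Z + d" "Y = Z + t *\<^sub>R d" unfolding t d_def by (simp_all add: algebra_simps)
  ultimately have "2 * (d \<bullet> Z) + d \<bullet> d - 2 * (c \<bullet> d) = 0" "t * (2 * (d \<bullet> Z) + t * (d \<bullet> d) - 2 * (c \<bullet> d)) = 0"
    by (simp_all add: inner_simps inner_commute algebra_simps)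
  then have "t * (t - 1) * (d \<bullet> d) = 0" by algebra
  moreover have "d \<bullet> d \<noteq> 0" using assms(6) d_def by auto
  ultimately have "t = 0 \<or> t = 1" by simp
  then show False using t assms by auto
qed

lemma circle_through_three_points_unique:
  fixes X Y Z c c' :: point
  assumes "\<not> collinear {X, Y, Z}" "{X, Y, Z} \<subseteq> sphere c r" "{X, Y, Z} \<subseteq> sphere c' r'"
  shows "c = c'" "r = r'"
proof -
  have s: "U \<bullet> U - 2 * (e \<bullet> U) = \<rho>\<^sup>2 - e \<bullet> e" if "U \<in> sphere e \<rho>" for U e :: point and \<rho>
  proof -
    have "\<rho>\<^sup>2 = (norm (e - U))\<^sup>2" using that by (simp add: dist_norm)
    then show ?thesis by (simp add: power2_norm_eq_inner inner_simps inner_commute)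
  qed
  have "(c - c') \<bullet> (X - U) = 0" if "U \<in> {X, Y, Z}" for U
  proof -
    have "X \<bullet> X - 2 * (c \<bullet> X) = U \<bullet> U - 2 * (c \<bullet> U)" "X \<bullet> X - 2 * (c' \<bullet> X) = U \<bullet> U - 2 * (c' \<bullet> U)"
      using s[of X c r] s[of U c r] s[of X c' r'] s[of U c' r'] assms(2,3) that by auto
    then show ?thesis by (simp add: inner_simps)
  qed
  then have "c - c' = 0"
    by (intro eq_zero_if_orthogonal[OF _ _ not_collinear_cross[OF assms(1)]]) auto
  then show "c = c'" by simp
  then show "r = r'" using assms(2,3) by auto
qed

text \<open>Both sides compare the distance from the centre to the line with the radius, without square roots.\<close>

lemma meet_in_two_points_iff:
  assumes A: "A \<noteq> D" and r: "r > 0"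
  shows "meet_in_two_points (perp_line D A) (sphere c r) \<longleftrightarrow>
    ((c - D) \<bullet> (A - D) - (A - D) \<bullet> (A - D))\<^sup>2 < r\<^sup>2 * ((A - D) \<bullet> (A - D))"
proof -
  define a where "a = A - D"
  define u where "u = c - D"
  have a0: "a \<noteq> 0" using A by (simp add: a_def)
  define N where "N = a \<bullet> a"
  have N: "N > 0" using a0 by (simp add: N_def)
  define \<delta> where "\<delta> = r\<^sup>2 * N - (u \<bullet> a - N)\<^sup>2"
  have mem: "X \<in> perp_line D A \<inter> sphere c r \<longleftrightarrow>
      (X - D) \<bullet> a = N \<and> ((X - D) \<bullet> rot90 a - u \<bullet> rot90 a)\<^sup>2 = \<delta>" for X
  proof -
    have "X \<in> sphere c r \<longleftrightarrow> (norm ((X - D) - u))\<^sup>2 = r\<^sup>2"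
      using r by (simp add: u_def dist_norm norm_minus_commute)
    also have "\<dots> \<longleftrightarrow> N * (((X - D) - u) \<bullet> ((X - D) - u)) = N * r\<^sup>2"
      using N by (simp add: power2_norm_eq_inner)
    also have "N * (((X - D) - u) \<bullet> ((X - D) - u)) = ((X - D) \<bullet> a - u \<bullet> a)\<^sup>2 + ((X - D) \<bullet> rot90 a - u \<bullet> rot90 a)\<^sup>2"
      unfolding N_def frame_inner[of a] by (simp add: inner_diff_left[of "X - D"] power2_eq_square)
    finally show ?thesis
      unfolding Int_iff perp_line_iff a_def[symmetric] N_def[symmetric] \<delta>_def
      by (auto simp: power2_commute[of N] algebra_simps)
  qed
  have eqI: "X = Y" if "(X - D) \<bullet> a = (Y - D) \<bullet> a" "(X - D) \<bullet> rot90 a = (Y - D) \<bullet> rot90 a" for X Y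
    using crd_eqI[OF a0, of "X - D" "Y - D"] that by (simp add: crd1_def crd2_def)
  have "meet_in_two_points (perp_line D A) (sphere c r) \<longleftrightarrow> \<delta> > 0"
  proof
    assume "meet_in_two_points (perp_line D A) (sphere c r)"
    then obtain X Y where XY: "X \<noteq> Y" "perp_line D A \<inter> sphere c r = {X, Y}"
      unfolding meet_in_two_points_def by blast
    then have X: "(X - D) \<bullet> a = N" "((X - D) \<bullet> rot90 a - u \<bullet> rot90 a)\<^sup>2 = \<delta>"
      and Y: "(Y - D) \<bullet> a = N" "((Y - D) \<bullet> rot90 a - u \<bullet> rot90 a)\<^sup>2 = \<delta>"
      using mem by blast+
    have "\<delta> \<ge> 0" using X(2) by (metis zero_le_power2)
    moreover have "\<delta> \<noteq> 0" using eqI[of X Y] X Y XY(1) by auto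
    ultimately show "\<delta> > 0" by simp
  next
    assume \<delta>: "\<delta> > 0"
    define f where "f s = D + a + ((u \<bullet> rot90 a + s) / N) *\<^sub>R rot90 a" for s
    have f: "(f s - D) \<bullet> a = N" "(f s - D) \<bullet> rot90 a = u \<bullet> rot90 a + s" for s
      using N by (simp_all add: f_def inner_simps inner_rot90 N_def)
    have "perp_line D A \<inter> sphere c r = {f (sqrt \<delta>), f (- sqrt \<delta>)}"
    proof (rule set_eqI)
      fix X
      have "((X - D) \<bullet> rot90 a - u \<bullet> rot90 a)\<^sup>2 = \<delta> \<longleftrightarrow>
          (X - D) \<bullet> rot90 a = u \<bullet> rot90 a + sqrt \<delta> \<or> (X - D) \<bullet> rot90 a = u \<bullet> rot90 a + - sqrt \<delta>"
      proof -
        have "((X - D) \<bullet> rot90 a - u \<bullet> rot90 a)\<^sup>2 = \<delta> \<longleftrightarrow> ((X - D) \<bullet> rot90 a - u \<bullet> rot90 a)\<^sup>2 = (sqrt \<delta>)\<^sup>2"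
          using \<delta> by simp
        then show ?thesis unfolding power2_eq_iff by linarith
      qed
      then show "X \<in> perp_line D A \<inter> sphere c r \<longleftrightarrow> X \<in> {f (sqrt \<delta>), f (- sqrt \<delta>)}"
        unfolding mem using eqI f by (metis insert_iff singleton_iff)
    qed
    moreover have "f (sqrt \<delta>) \<noteq> f (- sqrt \<delta>)"
      using f(2)[of "sqrt \<delta>"] f(2)[of "- sqrt \<delta>"] \<delta> by auto
    ultimately show "meet_in_two_points (perp_line D A) (sphere c r)"
      unfolding meet_in_two_points_def by blast
  qed
  then show ?thesis unfolding \<delta>_def u_def[symmetric] a_def[symmetric] N_def[symmetric] by simp
qed

lemma meet_in_two_pointsI:
  assumes "A \<noteq> D" "X \<noteq> Y" "{X, Y} \<subseteq> perp_line D A" "{X, Y} \<subseteq> sphere c r"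
  shows "meet_in_two_points (perp_line D A) (sphere c r)"
proof -
  have "Z \<in> {X, Y}" if Z: "Z \<in> perp_line D A" "Z \<in> sphere c r" for Z
  proof (rule ccontr)
    assume "Z \<notin> {X, Y}"
    then have "\<not> collinear {X, Y, Z}" using assms Z by (intro sphere_not_collinear[of _ c r]) auto
    moreover have "Z \<in> affine hull {X, Y}"
      using affine_hull_eq_perp_line[of A D X Y] assms Z by auto
    ultimately show False using affine_hull_3_imp_collinear by blast
  qed
  then have "perp_line D A \<inter> sphere c r = {X, Y}" using assms by blast
  then show ?thesis unfolding meet_in_two_points_def using assms(2) by blast
qed

lemma projection_on_perp_line:
  assumes "V \<noteq> D" "X \<in> perp_line D V" "Y \<in> perp_line D V" "X \<noteq> Y"
  shows "is_projection V D X Y"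
proof -
  have "V \<in> affine hull {X, Y}" unfolding affine_hull_eq_perp_line[OF assms] by (simp add: perp_line_iff)
  moreover have "(Y - X) \<bullet> (V - D) = 0"
  proof -
    have "Y - X = (Y - D) - (X - D)" by simp
    then show ?thesis
      using assms(2,3) unfolding perp_line_iff by (simp only: inner_diff_left[of "Y - D"] right_minus_eq)
  qed
  moreover have "(D - V) \<bullet> (Y - X) = - ((Y - X) \<bullet> (V - D))"
    by (metis inner_commute inner_minus_left minus_diff_eq)
  ultimately show ?thesis unfolding is_projection_def orthogonal_def by simp
qed

lemma perp_lines_meet:
  assumes "(V - D) \<bullet> rot90 (W - D) \<noteq> 0"
  obtains X where "perp_line D V \<inter> perp_line D W = {X}"
proof -
  define v w \<Delta> where "v = V - D" and "w = W - D" and "\<Delta> = v \<bullet> rot90 w"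
  have \<Delta>: "\<Delta> \<noteq> 0" using assms by (simp add: v_def w_def \<Delta>_def)
  define x where "x = ((v \<bullet> v) / \<Delta>) *\<^sub>R rot90 w - ((w \<bullet> w) / \<Delta>) *\<^sub>R rot90 v"
  have "rot90 w \<bullet> v = \<Delta>" "rot90 v \<bullet> w = - \<Delta>"
    unfolding \<Delta>_def by (rule inner_commute inner_rot90(3))+
  then have x: "x \<bullet> v = v \<bullet> v" "x \<bullet> w = w \<bullet> w"
    using \<Delta> by (simp_all add: x_def inner_diff_left inner_rot90)
  have "perp_line D V \<inter> perp_line D W = {D + x}"
  proof (rule set_eqI)
    fix X
    have "X - D - x = 0" if "(X - D) \<bullet> v = v \<bullet> v" "(X - D) \<bullet> w = w \<bullet> w"
      by (rule eq_zero_if_orthogonal[OF _ _ \<Delta>[unfolded \<Delta>_def]]) (use that x in \<open>simp_all add: inner_diff_left[of "X - D"]\<close>)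
    then show "X \<in> perp_line D V \<inter> perp_line D W \<longleftrightarrow> X \<in> {D + x}"
      unfolding Int_iff perp_line_iff v_def[symmetric] w_def[symmetric]
      using x by (auto simp: algebra_simps)
  qed
  then show thesis by (rule that)
qed

lemma sphere_misses_focus:
  fixes c D :: point
  assumes "D \<notin> sphere c r" "r > 0"
  shows "(c - D) \<bullet> (c - D) - r\<^sup>2 \<noteq> 0"
  using assms sphere_iff[of r D c D] by simp

section \<open>Conics in focal form\<close>

text \<open>This identifies the component of a focus once the complement of the conic is split by the sign of its equation.\<close>

lemma connected_component_clopen:
  assumes "open S" "connected S" "open T" "S \<inter> T = {}" "S \<union> T = - K" "F \<in> S"
  shows "connected_component_set (- K) F = S"
proof
  show "S \<subseteq> connected_component_set (- K) F"
    by (rule connected_component_maximal) (use assms in auto)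
  let ?C = "connected_component_set (- K) F"
  have "?C \<subseteq> S \<union> T" using assms(5) connected_component_subset[of "- K" F] by simp
  moreover have "F \<in> ?C" using assms by auto
  ultimately have "T \<inter> ?C = {}"
    using connectedD[OF connected_connected_component assms(1,3), of "- K" F] assms(4,6) by blast
  with \<open>?C \<subseteq> S \<union> T\<close> show "?C \<subseteq> S" by blast
qed

text \<open>One of the two convex regions that make up the inside of a conic with focus \<open>D\<close>; the other one has \<open>- w\<close> and \<open>- \<kappa>\<close> in
  place of \<open>w\<close> and \<open>\<kappa>\<close>, and it is nonempty besides this one only for a hyperbola.\<close>

definition focal_region :: "point \<Rightarrow> real \<Rightarrow> point \<Rightarrow> real \<Rightarrow> point set" where
  "focal_region D \<rho> w \<kappa> = {X. \<rho> * norm (X - D) < w \<bullet> (X - D) + \<kappa>}"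

lemma focal_region_open: "open (focal_region D \<rho> w \<kappa>)"
  unfolding focal_region_def by (intro open_Collect_less continuous_intros)

lemma focal_region_convex: 
  assumes "\<rho> \<ge> 0" shows "convex (focal_region D \<rho> w \<kappa>)"
proof (rule convexI)
  fix X Y u v assume X: "X \<in> focal_region D \<rho> w \<kappa>" and Y: "Y \<in> focal_region D \<rho> w \<kappa>"
    and u: "0 \<le> u" and v: "0 \<le> (v::real)" and uv: "u + v = 1"
  have e: "u *\<^sub>R X + v *\<^sub>R Y - D = u *\<^sub>R (X - D) + v *\<^sub>R (Y - D)"
    using uv by (simp add: algebra_simps flip: scaleR_add_left)
  have "norm (u *\<^sub>R (X - D) + v *\<^sub>R (Y - D)) \<le> u * norm (X - D) + v * norm (Y - D)"
    using u v norm_triangle_ineq[of "u *\<^sub>R (X - D)" "v *\<^sub>R (Y - D)"] by simp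
  then have "\<rho> * norm (u *\<^sub>R X + v *\<^sub>R Y - D) \<le> u * (\<rho> * norm (X - D)) + v * (\<rho> * norm (Y - D))"
    unfolding e using mult_left_mono[OF _ assms] by (fastforce simp: algebra_simps)
  also have "\<dots> < u * (w \<bullet> (X - D) + \<kappa>) + v * (w \<bullet> (Y - D) + \<kappa>)"
  proof (cases "u = 0")
    case True then show ?thesis using Y uv by (simp add: focal_region_def)
  next
    case False
    then have "u > 0" using u by simp
    then show ?thesis using X Y v
      by (intro add_less_le_mono mult_strict_left_mono mult_left_mono) (auto simp: focal_region_def)
  qed
  also have "\<dots> = w \<bullet> (u *\<^sub>R X + v *\<^sub>R Y - D) + (u + v) * \<kappa>"
    unfolding e by (simp add: inner_simps algebra_simps)
  finally show "u *\<^sub>R X + v *\<^sub>R Y \<in> focal_region D \<rho> w \<kappa>"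
    using uv by (simp add: focal_region_def)
qed

text \<open>The complement of the conic is the disjoint union of two convex open regions and the open outer region, so the component of a focus
  is one of the convex regions. Hyperbolas need both foci here, one for each branch.\<close>

lemma conic_inside_focal:
  assumes \<gamma>: "\<gamma> = {X. \<rho> * norm (X - D) = \<bar>w \<bullet> (X - D) + \<kappa>\<bar>}" and \<rho>: "\<rho> \<ge> 0"
    and \<Phi>: "\<Phi> \<subseteq> focal_region D \<rho> w \<kappa> \<union> focal_region D \<rho> (- w) (- \<kappa>)"
      "focal_region D \<rho> w \<kappa> \<noteq> {} \<Longrightarrow> \<Phi> \<inter> focal_region D \<rho> w \<kappa> \<noteq> {}"
      "focal_region D \<rho> (- w) (- \<kappa>) \<noteq> {} \<Longrightarrow> \<Phi> \<inter> focal_region D \<rho> (- w) (- \<kappa>) \<noteq> {}"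
  shows "conic_inside \<gamma> \<Phi> = {X. \<rho> * norm (X - D) < \<bar>w \<bullet> (X - D) + \<kappa>\<bar>}"
proof -
  let ?S = "focal_region D \<rho> w \<kappa>" and ?T = "focal_region D \<rho> (- w) (- \<kappa>)"
  define E where "E = {X. \<bar>w \<bullet> (X - D) + \<kappa>\<bar> < \<rho> * norm (X - D)}"
  have oE: "open E" unfolding E_def by (intro open_Collect_less continuous_intros)
  have nn: "0 \<le> \<rho> * norm (X - D)" for X using \<rho> by simp
  have disj: "?S \<inter> ?T = {}" "?S \<inter> E = {}" "?T \<inter> E = {}"
    by (auto simp: focal_region_def E_def) (smt (verit) nn)+
  have un: "?S \<union> ?T \<union> E = - \<gamma>"
    using nn by (fastforce simp: focal_region_def E_def \<gamma> abs_if split: if_splits)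
  have S: "connected_component_set (- \<gamma>) F = ?S" if "F \<in> ?S" for F
    by (rule connected_component_clopen[of _ "?T \<union> E"])
      (use that oE focal_region_open disj un in \<open>auto simp: Un_ac intro: convex_connected focal_region_convex[OF \<rho>]\<close>)
  have T: "connected_component_set (- \<gamma>) F = ?T" if "F \<in> ?T" for F
    by (rule connected_component_clopen[of _ "?S \<union> E"])
      (use that oE focal_region_open disj un in \<open>auto simp: Un_ac intro: convex_connected focal_region_convex[OF \<rho>]\<close>)
  have "conic_inside \<gamma> \<Phi> = ?S \<union> ?T"
  proof
    show "conic_inside \<gamma> \<Phi> \<subseteq> ?S \<union> ?T"
      unfolding conic_inside_def
    proof (rule UN_least)
      fix F assume "F \<in> \<Phi>"
      then have "F \<in> ?S \<or> F \<in> ?T" using \<Phi>(1) by auto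
      then show "connected_component_set (- \<gamma>) F \<subseteq> ?S \<union> ?T" using S[of F] T[of F] by auto
    qed
    have "?S \<subseteq> conic_inside \<gamma> \<Phi>"
    proof (cases "?S = {}")
      case False
      then obtain F where "F \<in> \<Phi>" "F \<in> ?S" using \<Phi>(2) by auto
      then show ?thesis unfolding conic_inside_def using S[of F] by blast
    qed simp
    moreover have "?T \<subseteq> conic_inside \<gamma> \<Phi>"
    proof (cases "?T = {}")
      case False
      then obtain F where "F \<in> \<Phi>" "F \<in> ?T" using \<Phi>(3) by auto
      then show ?thesis unfolding conic_inside_def using T[of F] by blast
    qed simp
    ultimately show "?S \<union> ?T \<subseteq> conic_inside \<gamma> \<Phi>" by blast
  qed
  also have "\<dots> = {X. \<rho> * norm (X - D) < \<bar>w \<bullet> (X - D) + \<kappa>\<bar>}"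
    by (auto simp: focal_region_def abs_if)
  finally show ?thesis .
qed

text \<open>Squaring the bifocal equation once. Of the three sign combinations on the right, the triangle inequality retains the one for
  the ellipse if \<open>|g| < 2 a\<close> and the two for the hyperbola if \<open>|g| > 2 a\<close>.\<close>

lemma bifocal_eq:
  fixes x g :: point
  assumes "a > 0" 
  shows "4 * a * norm x = \<bar>(2 *\<^sub>R g) \<bullet> x + (4 * a\<^sup>2 - (norm g)\<^sup>2)\<bar> \<longleftrightarrow>
     norm (x - g) = \<bar>norm x - 2 * a\<bar> \<or> norm (x - g) = norm x + 2 * a"
proof -
  define n d where "n = norm x" and "d = norm (x - g)"
  have nd: "n \<ge> 0" "d \<ge> 0" by (simp_all add: n_def d_def)
  have "(2 *\<^sub>R g) \<bullet> x = n\<^sup>2 + (norm g)\<^sup>2 - d\<^sup>2"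
    unfolding n_def d_def power2_norm_eq_inner by (simp add: inner_simps inner_commute)
  then have "(2 *\<^sub>R g) \<bullet> x + (4 * a\<^sup>2 - (norm g)\<^sup>2) = n\<^sup>2 + 4 * a\<^sup>2 - d\<^sup>2" by linarith
  then have "4 * a * n = \<bar>(2 *\<^sub>R g) \<bullet> x + (4 * a\<^sup>2 - (norm g)\<^sup>2)\<bar> \<longleftrightarrow> 4 * a * n = \<bar>n\<^sup>2 + 4 * a\<^sup>2 - d\<^sup>2\<bar>"
    by (simp only:)
  also have "\<dots> \<longleftrightarrow> d\<^sup>2 = (n - 2 * a)\<^sup>2 \<or> d\<^sup>2 = (n + 2 * a)\<^sup>2"
  proof -
    have "(n - 2 * a)\<^sup>2 = n\<^sup>2 + 4 * a\<^sup>2 - 4 * a * n" "(n + 2 * a)\<^sup>2 = n\<^sup>2 + 4 * a\<^sup>2 + 4 * a * n"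
      by (simp_all add: power2_eq_square algebra_simps)
    moreover have "4 * a * n \<ge> 0" using assms nd by simp
    ultimately show ?thesis by linarith
  qed
  also have "\<dots> \<longleftrightarrow> d = \<bar>n - 2 * a\<bar> \<or> d = n + 2 * a"
  proof -
    have "d\<^sup>2 = (n - 2 * a)\<^sup>2 \<longleftrightarrow> d = \<bar>n - 2 * a\<bar>"
      using power2_eq_iff_nonneg[of d "\<bar>n - 2 * a\<bar>"] nd by simp
    moreover have "d\<^sup>2 = (n + 2 * a)\<^sup>2 \<longleftrightarrow> d = n + 2 * a"
      using power2_eq_iff_nonneg[of d "n + 2 * a"] nd assms by simp
    ultimately show ?thesis by simp
  qed
  finally show ?thesis unfolding n_def d_def .
qed

lemma infdist_line:
  fixes U V X :: point
  assumes "U \<noteq> V"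
  obtains \<nu> :: point where "norm \<nu> = 1" "\<And>X. infdist X (affine hull {U, V}) = \<bar>\<nu> \<bullet> (X - U)\<bar>"
proof -
  define d where "d = V - U"
  have d0: "d \<noteq> 0" using assms by (simp add: d_def)
  define \<nu> where "\<nu> = (1 / norm d) *\<^sub>R rot90 d"
  have \<nu>1: "norm \<nu> = 1" using d0 by (simp add: \<nu>_def norm_eq_sqrt_inner inner_rot90)
  have \<nu>d: "\<nu> \<bullet> d = 0" by (simp add: \<nu>_def inner_rot90)
  have perp: "norm x = \<bar>\<nu> \<bullet> x\<bar>" if "x \<bullet> d = 0" for x
  proof -
    have "(norm d * norm x)\<^sup>2 = (d \<bullet> d) * (x \<bullet> x)"
      by (simp add: power_mult_distrib power2_norm_eq_inner)
    also have "\<dots> = (rot90 d \<bullet> x)\<^sup>2"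
      using frame_inner[of d x x] that by (simp add: power2_eq_square inner_commute)
    finally have "(norm d * norm x)\<^sup>2 = (rot90 d \<bullet> x)\<^sup>2" .
    then have "\<bar>norm d * norm x\<bar> = \<bar>rot90 d \<bullet> x\<bar>" unfolding power2_eq_iff by linarith
    then have "norm d * norm x = \<bar>rot90 d \<bullet> x\<bar>" by simp
    then show ?thesis using d0 by (simp add: \<nu>_def abs_mult field_simps)
  qed
  have line: "affine hull {U, V} = {U + t *\<^sub>R d | t. True}"
    unfolding d_def affine_hull_2_alt by auto
  have "infdist X (affine hull {U, V}) = \<bar>\<nu> \<bullet> (X - U)\<bar>" for X
  proof (rule antisym)
    define t where "t = ((X - U) \<bullet> d) / (d \<bullet> d)"
    have "(X - (U + t *\<^sub>R d)) \<bullet> d = 0" using d0 by (simp add: t_def inner_simps)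
    from perp[OF this] have "dist X (U + t *\<^sub>R d) = \<bar>\<nu> \<bullet> (X - U)\<bar>"
      using \<nu>d by (simp add: dist_norm inner_simps)
    then show "infdist X (affine hull {U, V}) \<le> \<bar>\<nu> \<bullet> (X - U)\<bar>"
      using infdist_le[of "U + t *\<^sub>R d" "affine hull {U, V}" X] line by auto
    obtain Y where Y: "Y \<in> affine hull {U, V}" "infdist X (affine hull {U, V}) = dist X Y"
      using infdist_attains_inf[of "affine hull {U, V}" X] by (auto simp: closed_affine_hull)
    then obtain s where "Y = U + s *\<^sub>R d" using line by auto
    then have "\<nu> \<bullet> (X - Y) = \<nu> \<bullet> (X - U)" using \<nu>d by (simp add: inner_simps)
    then show "\<bar>\<nu> \<bullet> (X - U)\<bar> \<le> infdist X (affine hull {U, V})"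
      using Cauchy_Schwarz_ineq2[of \<nu> "X - Y"] \<nu>1 Y by (simp add: dist_norm)
  qed
  with \<nu>1 show thesis by (rule that)
qed

text \<open>The focus-directrix equation, homogenised so that it also includes circles (\<open>w = 0\<close>, no directrix).
  For a conic with foci \<open>D\<close> and \<open>D + g\<close> take \<open>\<rho> = 4 a\<close>, \<open>w = 2 g\<close>, \<open>\<kappa> = 4 a\<^sup>2 - |g|\<^sup>2\<close>; for a parabola \<open>\<rho> = 1\<close> and \<open>w\<close> is the unit normal
  of the directrix that points towards the focus.\<close>

lemma conic_focal_form:
  assumes con: "is_conic_with_foci \<gamma> \<Phi>" and D: "D \<in> \<Phi>"
  obtains \<rho> w \<kappa> where "\<rho> > 0" "\<kappa> \<noteq> 0"
    "\<gamma> = {X. \<rho> * norm (X - D) = \<bar>w \<bullet> (X - D) + \<kappa>\<bar>}"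
    "conic_inside \<gamma> \<Phi> = {X. \<rho> * norm (X - D) < \<bar>w \<bullet> (X - D) + \<kappa>\<bar>}"
proof -
  from con consider
    (ellipse) F G a where "dist F G < 2 * a" "\<Phi> = {F, G}" "\<gamma> = {X. dist X F + dist X G = 2 * a}"
  | (hyperbola) F G a where "0 < a" "2 * a < dist F G" "\<Phi> = {F, G}" "\<gamma> = {X. \<bar>dist X F - dist X G\<bar> = 2 * a}"
  | (parabola) F U V where "U \<noteq> V" "F \<notin> affine hull {U, V}" "\<Phi> = {F}"
     "\<gamma> = {X. dist X F = infdist X (affine hull {U, V})}"
    unfolding is_conic_with_foci_def
    by (elim disjE exE conjE) (rule that(1); assumption | rule that(2); assumption | rule that(3); assumption)+
  then show thesis
  proof cases
    case ellipse
    have "dist G F < 2 * a" "\<Phi> = {G, F}" "\<gamma> = {X. dist X G + dist X F = 2 * a}"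
      using ellipse by (simp_all add: dist_commute[of G] insert_commute add.commute)
    then obtain G where G: "dist D G < 2 * a" "\<Phi> = {D, G}" "\<gamma> = {X. dist X D + dist X G = 2 * a}"
      using ellipse D by blast
    have a: "a > 0" using G(1) zero_le_dist[of D G] by linarith
    define g where "g = G - D"
    define \<rho> w \<kappa> where "\<rho> = 4 * a" "w = 2 *\<^sub>R g" "\<kappa> = 4 * a\<^sup>2 - (norm g)\<^sup>2"
    note defs = this
    have g: "norm g < 2 * a" using G(1) by (simp add: g_def dist_norm norm_minus_commute)
    then have "(norm g)\<^sup>2 < (2 * a)\<^sup>2" by (intro power_strict_mono) auto
    then have \<kappa>: "\<kappa> > 0" by (simp add: defs power_mult_distrib)
    have form: "\<gamma> = {X. \<rho> * norm (X - D) = \<bar>w \<bullet> (X - D) + \<kappa>\<bar>}"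
    proof -
      have "dist X D + dist X G = 2 * a \<longleftrightarrow> norm (X - D - g) = \<bar>norm (X - D) - 2 * a\<bar> \<or> norm (X - D - g) = norm (X - D) + 2 * a" for X
      proof -
        have e: "X - D - g = X - G" by (simp add: g_def)
        have "norm (X - D) \<le> norm (X - G) + norm g" "norm (X - G) \<le> norm (X - D) + norm g"
          using norm_triangle_ineq[of "X - G" g] norm_triangle_ineq4[of "X - D" g] by (simp_all add: g_def)
        then show ?thesis using g a unfolding e dist_norm by linarith
      qed
      then show ?thesis unfolding G(3) defs bifocal_eq[OF a] by blast
    qed
    have S: "D \<in> focal_region D \<rho> w \<kappa>" using \<kappa> by (simp add: focal_region_def)
    have "0 < (2 * a - norm g)\<^sup>2" using g by simp
    then have "4 * a * norm g < 4 * a\<^sup>2 + (norm g)\<^sup>2" by (simp add: power2_diff power_mult_distrib)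
    then have S2: "G \<in> focal_region D \<rho> w \<kappa>"
      by (simp add: focal_region_def defs g_def[symmetric] flip: power2_norm_eq_inner)
    have T: "focal_region D \<rho> (- w) (- \<kappa>) = {}"
    proof -
      have "\<not> \<rho> * norm x < - w \<bullet> x - \<kappa>" for x
      proof -
        have "\<bar>g \<bullet> x\<bar> \<le> norm g * norm x" by (rule Cauchy_Schwarz_ineq2)
        also have "\<dots> \<le> 2 * a * norm x" using g by (intro mult_right_mono) auto
        finally show ?thesis using \<kappa> by (simp add: defs)
      qed
      then show ?thesis by (simp add: focal_region_def)
    qed
    have "conic_inside \<gamma> \<Phi> = {X. \<rho> * norm (X - D) < \<bar>w \<bullet> (X - D) + \<kappa>\<bar>}"
      by (rule conic_inside_focal[OF form]) (use a S S2 T G(2) in \<open>auto simp: defs\<close>)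
    then show thesis using that[of \<rho> \<kappa> w] form a \<kappa> by (simp add: defs)
  next
    case hyperbola
    have "2 * a < dist G F" "\<Phi> = {G, F}" "\<gamma> = {X. \<bar>dist X G - dist X F\<bar> = 2 * a}"
      using hyperbola by (simp_all add: dist_commute[of G] insert_commute abs_minus_commute)
    then obtain G where G: "2 * a < dist D G" "\<Phi> = {D, G}" "\<gamma> = {X. \<bar>dist X D - dist X G\<bar> = 2 * a}"
      using hyperbola D by blast
    note a = hyperbola(1)
    define g where "g = G - D"
    define \<rho> w \<kappa> where "\<rho> = 4 * a" "w = 2 *\<^sub>R g" "\<kappa> = 4 * a\<^sup>2 - (norm g)\<^sup>2"
    note defs = this
    have g: "norm g > 2 * a" using G(1) by (simp add: g_def dist_norm norm_minus_commute)
    then have "(norm g)\<^sup>2 > (2 * a)\<^sup>2" using a by (intro power_strict_mono) auto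
    then have \<kappa>: "\<kappa> < 0" by (simp add: defs power_mult_distrib)
    have form: "\<gamma> = {X. \<rho> * norm (X - D) = \<bar>w \<bullet> (X - D) + \<kappa>\<bar>}"
    proof -
      have "\<bar>dist X D - dist X G\<bar> = 2 * a \<longleftrightarrow> norm (X - D - g) = \<bar>norm (X - D) - 2 * a\<bar> \<or> norm (X - D - g) = norm (X - D) + 2 * a" for X
      proof -
        have e: "X - D - g = X - G" by (simp add: g_def)
        have "norm g \<le> norm (X - D) + norm (X - G)"
          using norm_triangle_ineq4[of "X - D" "X - G"] by (simp add: g_def)
        then show ?thesis using g a unfolding e dist_norm by linarith
      qed
      then show ?thesis unfolding G(3) defs bifocal_eq[OF a] by blast
    qed
    have T: "D \<in> focal_region D \<rho> (- w) (- \<kappa>)" using \<kappa> by (simp add: focal_region_def)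
    have "0 < (2 * a - norm g)\<^sup>2" using g by simp
    then have "4 * a * norm g < 4 * a\<^sup>2 + (norm g)\<^sup>2" by (simp add: power2_diff power_mult_distrib)
    then have S: "G \<in> focal_region D \<rho> w \<kappa>"
      by (simp add: focal_region_def defs g_def[symmetric] flip: power2_norm_eq_inner)
    have "conic_inside \<gamma> \<Phi> = {X. \<rho> * norm (X - D) < \<bar>w \<bullet> (X - D) + \<kappa>\<bar>}"
      by (rule conic_inside_focal[OF form]) (use a S T G(2) in \<open>auto simp: defs\<close>)
    then show thesis using that[of \<rho> \<kappa> w] form a \<kappa> by (simp add: defs)
  next
    case parabola
    have F: "F = D" using parabola D by simp
    obtain \<nu> where \<nu>: "norm \<nu> = 1" "\<And>X. infdist X (affine hull {U, V}) = \<bar>\<nu> \<bullet> (X - U)\<bar>"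
      using infdist_line[OF parabola(1)] by blast
    have "infdist D (affine hull {U, V}) \<noteq> 0"
      using parabola(2) in_closed_iff_infdist_zero[of "affine hull {U, V}" D] F by (auto simp: closed_affine_hull)
    then have \<nu>D: "\<nu> \<bullet> (D - U) \<noteq> 0" using \<nu>(2) by simp
    \<comment> \<open>orient the unit normal towards the focus\<close>
    define w where "w = sgn (\<nu> \<bullet> (D - U)) *\<^sub>R \<nu>"
    define \<kappa> where "\<kappa> = w \<bullet> (D - U)"
    have w1: "norm w = 1" using \<nu> \<nu>D by (simp add: w_def sgn_if)
    have \<kappa>: "\<kappa> > 0" using \<nu>D by (auto simp: \<kappa>_def w_def sgn_if)
    have "\<bar>w \<bullet> (X - D) + \<kappa>\<bar> = \<bar>\<nu> \<bullet> (X - U)\<bar>" for X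
    proof -
      have "w \<bullet> (X - D) + \<kappa> = w \<bullet> (X - U)" by (simp add: \<kappa>_def inner_simps)
      then show ?thesis using \<nu>D by (simp add: w_def abs_mult)
    qed
    then have form: "\<gamma> = {X. 1 * norm (X - D) = \<bar>w \<bullet> (X - D) + \<kappa>\<bar>}"
      unfolding parabola(4) \<nu>(2) by (simp add: F dist_norm)
    have S: "D \<in> focal_region D 1 w \<kappa>" using \<kappa> by (simp add: focal_region_def)
    have T: "focal_region D 1 (- w) (- \<kappa>) = {}"
    proof -
      have "\<not> norm x < - (w \<bullet> x) - \<kappa>" for x
        using Cauchy_Schwarz_ineq2[of w x] w1 \<kappa> by simp
      then show ?thesis by (simp add: focal_region_def)
    qed
    have "conic_inside \<gamma> \<Phi> = {X. 1 * norm (X - D) < \<bar>w \<bullet> (X - D) + \<kappa>\<bar>}"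
      by (rule conic_inside_focal[OF form]) (use S T parabola(3) F in auto)
    then show thesis using that[of 1 \<kappa> w] form \<kappa> by simp
  qed
qed

section \<open>Tangent lines of a conic in focal form\<close>

text \<open>On the line \<open>n \<bullet> x = 1\<close> the equation of the conic becomes the quadratic form \<open>\<rho>\<^sup>2 |x|\<^sup>2 = (m \<bullet> x)\<^sup>2\<close> with \<open>m = w + \<kappa> n\<close>. At a point of contact
  this form has a double zero, so \<open>x\<close> is an eigenvector: \<open>\<rho>\<^sup>2 x = (m \<bullet> x) m\<close>, whence \<open>|m| = \<rho>\<close>.\<close>

lemma touching_line_dual:
  assumes \<gamma>: "\<gamma> = {X. \<rho> * norm (X - D) = \<bar>w \<bullet> (X - D) + \<kappa>\<bar>}" and \<rho>: "\<rho> > 0"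
    and l: "l \<subseteq> {X. n \<bullet> (X - D) = 1}" and t: "touches l \<gamma>"
  shows "norm (w + \<kappa> *\<^sub>R n) = \<rho>"
proof -
  obtain p v e where e: "0 < e" and p: "\<And>t. \<bar>t\<bar> < e \<Longrightarrow> p t \<in> \<gamma>"
    and v: "(p has_vector_derivative v) (at 0)" "v \<noteq> 0" and lv: "l = range (\<lambda>s. p 0 + s *\<^sub>R v)"
    using t unfolding touches_def by blast
  \<comment> \<open>the squared equation of the conic, constant along \<open>p\<close>\<close>
  define h where "h t = (w \<bullet> (p t - D) + \<kappa>)\<^sup>2 - \<rho>\<^sup>2 * ((p t - D) \<bullet> (p t - D))" for t
  have \<gamma>2: "(w \<bullet> (X - D) + \<kappa>)\<^sup>2 = \<rho>\<^sup>2 * ((X - D) \<bullet> (X - D))" if "X \<in> \<gamma>" for X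
  proof -
    have "(w \<bullet> (X - D) + \<kappa>)\<^sup>2 = (\<rho> * norm (X - D))\<^sup>2" using that \<gamma> by simp
    then show ?thesis by (simp add: power_mult_distrib power2_norm_eq_inner)
  qed
  define x where "x = p 0 - D"
  have h0: "h t = 0" if "\<bar>t\<bar> < e" for t
    unfolding h_def using \<gamma>2[OF p[OF that]] by simp
  have "(h has_derivative (\<lambda>t. 2 * (w \<bullet> x + \<kappa>) * (w \<bullet> (t *\<^sub>R v)) - \<rho>\<^sup>2 * (2 * (x \<bullet> (t *\<^sub>R v))))) (at 0)"
    unfolding h_def x_def
    by (rule derivative_eq_intros refl v(1)[unfolded has_vector_derivative_def] | simp add: inner_commute algebra_simps)+
  then have "(h has_field_derivative (2 * (w \<bullet> x + \<kappa>) * (w \<bullet> v) - \<rho>\<^sup>2 * (2 * (x \<bullet> v)))) (at 0)"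
    unfolding has_field_derivative_def by (rule has_derivative_eq_rhs) (simp add: fun_eq_iff algebra_simps)
  then have "2 * (w \<bullet> x + \<kappa>) * (w \<bullet> v) - \<rho>\<^sup>2 * (2 * (x \<bullet> v)) = 0"
    by (rule DERIV_local_const[OF _ e]) (simp add: h0 e)
  then have d: "(w \<bullet> x + \<kappa>) * (w \<bullet> v) = \<rho>\<^sup>2 * (x \<bullet> v)" by algebra
  have "p 0 \<in> l" "p 0 + v \<in> l" unfolding lv
    using rangeI[of "\<lambda>s. p 0 + s *\<^sub>R v" 0] rangeI[of "\<lambda>s. p 0 + s *\<^sub>R v" 1] by simp_all
  then have nx: "n \<bullet> x = 1" and "n \<bullet> (p 0 + v - D) = 1" using l by (auto simp: x_def)
  then have nv: "n \<bullet> v = 0" by (simp add: x_def inner_simps)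
  define m where "m = w + \<kappa> *\<^sub>R n"
  have mx: "m \<bullet> x = w \<bullet> x + \<kappa>" and mv: "m \<bullet> v = w \<bullet> v"
    using nx nv by (simp_all add: m_def inner_simps)
  have x2: "(m \<bullet> x)\<^sup>2 = \<rho>\<^sup>2 * (x \<bullet> x)"
    using \<gamma>2[OF p[of 0]] e mx by (simp add: x_def)
  have "\<rho>\<^sup>2 *\<^sub>R x - (m \<bullet> x) *\<^sub>R m = 0"
  proof (rule eq_zero_if_orthogonal)
    show "(\<rho>\<^sup>2 *\<^sub>R x - (m \<bullet> x) *\<^sub>R m) \<bullet> x = 0"
      using x2 by (simp add: inner_simps power2_eq_square)
    show "(\<rho>\<^sup>2 *\<^sub>R x - (m \<bullet> x) *\<^sub>R m) \<bullet> v = 0"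
      using d mx mv by (simp add: inner_simps)
    show "x \<bullet> rot90 v \<noteq> 0"
      using frame_inner[of v n x] nx nv v(2) by auto
  qed
  then have "\<rho>\<^sup>2 *\<^sub>R x = (m \<bullet> x) *\<^sub>R m" by simp
  then have "(\<rho>\<^sup>2 *\<^sub>R x) \<bullet> (\<rho>\<^sup>2 *\<^sub>R x) = ((m \<bullet> x) *\<^sub>R m) \<bullet> ((m \<bullet> x) *\<^sub>R m)" by simp
  then have "\<rho>\<^sup>2 * (x \<bullet> x) * \<rho>\<^sup>2 = (m \<bullet> x)\<^sup>2 * (m \<bullet> m)" by (simp add: power2_eq_square algebra_simps)
  then have "\<rho>\<^sup>2 = m \<bullet> m" using x2 \<rho> nx by auto
  then have "\<rho>\<^sup>2 = (norm m)\<^sup>2" by (simp add: power2_norm_eq_inner)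
  then show ?thesis using \<rho> by (simp add: m_def)
qed

text \<open>The double zero of the quadratic form of a touching line now lies in the direction of the line itself. Comparing the orders
  \<open>c\<^sup>2\<close> and \<open>c\<close> in the equation of the conic, where \<open>c\<close> is the component of \<open>X\<close> along the line, gives \<open>\<beta>\<^sup>2 = \<rho>\<^sup>2 |n|\<^sup>2\<close> and \<open>\<alpha> = 0\<close> for the
  components of \<open>m\<close> along and across the line.\<close>

lemma asymptote_dual:
  assumes \<gamma>: "\<gamma> = {X. \<rho> * norm (X - D) = \<bar>w \<bullet> (X - D) + \<kappa>\<bar>}" and \<rho>: "\<rho> > 0"
    and l: "l \<subseteq> {X. n \<bullet> (X - D) = 1}" "closed l" "l \<noteq> {}" and t: "is_asymptote l \<gamma>"
  shows "norm (w + \<kappa> *\<^sub>R n) = \<rho>"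
proof -
  obtain X where X: "\<And>i. X i \<in> \<gamma>" and inf: "filterlim X at_infinity sequentially"
    and close: "(\<lambda>i. infdist (X i) l) \<longlonglongrightarrow> 0"
    using t unfolding is_asymptote_def by blast
  define x where "x i = X i - D" for i
  define N where "N = n \<bullet> n"
  have "n \<noteq> 0" using l by auto
  then have N: "N > 0" by (simp add: N_def)
  define \<epsilon> c where "\<epsilon> i = n \<bullet> x i - 1" and "c i = x i \<bullet> rot90 n" for i
  have "\<bar>\<epsilon> i\<bar> \<le> norm n * infdist (X i) l" for i
  proof -
    obtain Y where Y: "Y \<in> l" "infdist (X i) l = dist (X i) Y"
      using infdist_attains_inf[OF l(2,3)] by blast
    then have "\<epsilon> i = n \<bullet> (X i - Y)" using l(1) by (auto simp: \<epsilon>_def x_def inner_simps)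
    then show ?thesis using Cauchy_Schwarz_ineq2[of n "X i - Y"] Y by (simp add: dist_norm)
  qed
  moreover have "(\<lambda>i. norm n * infdist (X i) l) \<longlonglongrightarrow> 0"
    using tendsto_mult_left[OF close, of "norm n"] by simp
  ultimately have \<epsilon>: "\<epsilon> \<longlonglongrightarrow> 0"
    by (metis (no_types, lifting) Lim_null_comparison always_eventually real_norm_def)
  have xc: "N * (x i \<bullet> x i) = (1 + \<epsilon> i)\<^sup>2 + (c i)\<^sup>2" for i
    using frame_inner[of n "x i" "x i"] by (simp add: N_def \<epsilon>_def c_def power2_eq_square inner_commute)
  define m where "m = w + \<kappa> *\<^sub>R n"
  define \<alpha> \<beta> where "\<alpha> = m \<bullet> n" and "\<beta> = m \<bullet> rot90 n"
  have wm: "N * (w \<bullet> x i + \<kappa>) = \<beta> * c i + (\<alpha> + \<epsilon> i * (\<alpha> - N * \<kappa>))" for i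
  proof -
    have "N * (m \<bullet> x i) = \<alpha> * (1 + \<epsilon> i) + \<beta> * c i"
      using frame_inner[of n m "x i"] by (simp add: N_def \<alpha>_def \<beta>_def \<epsilon>_def c_def inner_commute)
    moreover have "m \<bullet> x i = w \<bullet> x i + \<kappa> + \<kappa> * \<epsilon> i" 
      by (simp add: m_def \<epsilon>_def inner_simps algebra_simps)
    ultimately show ?thesis by (simp add: algebra_simps)
  qed
  define d where "d i = \<alpha> + \<epsilon> i * (\<alpha> - N * \<kappa>)" for i
  have d: "d \<longlonglongrightarrow> \<alpha>" unfolding d_def 
    using tendsto_add[OF tendsto_const tendsto_mult_right[OF \<epsilon>]] by fastforce
  have eq: "\<rho>\<^sup>2 * N * ((1 + \<epsilon> i)\<^sup>2 + (c i)\<^sup>2) = (\<beta> * c i + d i)\<^sup>2" for i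
  proof -
    have "\<rho> * norm (x i) = \<bar>w \<bullet> x i + \<kappa>\<bar>" using X[of i] \<gamma> by (simp add: x_def)
    then have "(\<rho> * norm (x i))\<^sup>2 = (w \<bullet> x i + \<kappa>)\<^sup>2" by simp
    then have "\<rho>\<^sup>2 * (x i \<bullet> x i) = (w \<bullet> x i + \<kappa>)\<^sup>2" by (simp add: power_mult_distrib power2_norm_eq_inner)
    then have "\<rho>\<^sup>2 * N * (N * (x i \<bullet> x i)) = (N * (w \<bullet> x i + \<kappa>))\<^sup>2"
      by (simp add: power_mult_distrib power2_eq_square[of N])
    then show ?thesis unfolding wm xc d_def by (simp add: add.assoc)
  qed
  \<comment> \<open>the component along the line escapes to infinity\<close>
  have "filterlim (\<lambda>i. - norm D + norm (X i)) at_top sequentially"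
    by (rule filterlim_tendsto_add_at_top[OF tendsto_const filterlim_at_infinity_imp_norm_at_top[OF inf]])
  then have nx: "filterlim (\<lambda>i. norm (x i)) at_top sequentially"
    by (rule filterlim_at_top_mono) (use norm_triangle_ineq2[of "X _" D] in \<open>auto simp: x_def algebra_simps intro!: always_eventually\<close>)
  have "filterlim (\<lambda>i. N * (norm (x i) * norm (x i))) at_top sequentially"
    by (intro filterlim_tendsto_pos_mult_at_top[OF tendsto_const N] filterlim_at_top_mult_at_top nx)
  moreover have "(\<lambda>i. - (1 + \<epsilon> i)\<^sup>2) \<longlonglongrightarrow> - (1 + 0)\<^sup>2" by (intro tendsto_intros \<epsilon>)
  ultimately have "filterlim (\<lambda>i. - (1 + \<epsilon> i)\<^sup>2 + N * (norm (x i) * norm (x i))) at_top sequentially"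
    by (rule filterlim_tendsto_add_at_top[rotated])
  moreover have "- (1 + \<epsilon> i)\<^sup>2 + N * (norm (x i) * norm (x i)) = (c i)\<^sup>2" for i
    using xc[of i] by (simp add: power2_norm_eq_inner flip: power2_eq_square)
  ultimately have c2: "filterlim (\<lambda>i. (c i)\<^sup>2) at_top sequentially" by simp
  define r where "r i = 1 / c i" for i
  have "(\<lambda>i. (r i)\<^sup>2) \<longlonglongrightarrow> 0"
    using tendsto_inverse_0_at_top[OF c2] by (simp add: r_def power_one_over inverse_eq_divide)
  then have "(\<lambda>i. \<bar>r i\<bar>) \<longlonglongrightarrow> 0" using tendsto_real_sqrt by fastforce
  then have r: "r \<longlonglongrightarrow> 0" by (rule tendsto_rabs_zero_cancel)
  have c0: "eventually (\<lambda>i. c i \<noteq> 0) sequentially"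
    using filterlim_at_top_dense[THEN iffD1, OF c2, rule_format, of 0] by (auto elim!: eventually_mono)
  \<comment> \<open>the equation divided by \<open>c\<^sup>2\<close>\<close>
  have L1: "(\<lambda>i. \<rho>\<^sup>2 * N * ((1 + \<epsilon> i)\<^sup>2 * (r i)\<^sup>2 + 1)) \<longlonglongrightarrow> \<rho>\<^sup>2 * N * ((1 + 0)\<^sup>2 * 0\<^sup>2 + 1)"
    by (intro tendsto_intros \<epsilon> r)
  have L2: "(\<lambda>i. (\<beta> + d i * r i)\<^sup>2) \<longlonglongrightarrow> (\<beta> + \<alpha> * 0)\<^sup>2"
    by (intro tendsto_intros d r)
  have ev: "eventually (\<lambda>i. \<rho>\<^sup>2 * N * ((1 + \<epsilon> i)\<^sup>2 * (r i)\<^sup>2 + 1) = (\<beta> + d i * r i)\<^sup>2) sequentially"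
    using c0
  proof eventually_elim
    case (elim i)
    then have "c i * r i = 1" by (simp add: r_def)
    then show ?case using eq[of i] by algebra
  qed
  have \<beta>: "\<rho>\<^sup>2 * N = \<beta>\<^sup>2"
    using LIMSEQ_unique[OF iffD1[OF tendsto_cong[OF ev] L1] L2] by simp
  \<comment> \<open>the terms with \<open>c\<^sup>2\<close> cancel, and the rest is divided by \<open>c\<close>\<close>
  have L3: "(\<lambda>i. \<rho>\<^sup>2 * N * (1 + \<epsilon> i)\<^sup>2 * r i) \<longlonglongrightarrow> \<rho>\<^sup>2 * N * (1 + 0)\<^sup>2 * 0"
    by (intro tendsto_intros \<epsilon> r)
  have L4: "(\<lambda>i. 2 * \<beta> * d i + (d i)\<^sup>2 * r i) \<longlonglongrightarrow> 2 * \<beta> * \<alpha> + \<alpha>\<^sup>2 * 0"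
    by (intro tendsto_intros d r)
  have ev: "eventually (\<lambda>i. \<rho>\<^sup>2 * N * (1 + \<epsilon> i)\<^sup>2 * r i = 2 * \<beta> * d i + (d i)\<^sup>2 * r i) sequentially"
    using c0
  proof eventually_elim
    case (elim i)
    then have "c i * r i = 1" by (simp add: r_def)
    then show ?case using eq[of i] \<beta> by algebra
  qed
  have "2 * \<beta> * \<alpha> = 0"
    using LIMSEQ_unique[OF iffD1[OF tendsto_cong[OF ev] L3] L4] by simp
  moreover have "\<beta> \<noteq> 0" using \<beta> \<rho> N by auto
  ultimately have "\<alpha> = 0" by simp
  then have "N * (m \<bullet> m) = N * \<rho>\<^sup>2"
    using frame_inner[of n m m] \<beta> by (simp add: N_def \<alpha>_def \<beta>_def power2_eq_square algebra_simps)
  then have "(norm m)\<^sup>2 = \<rho>\<^sup>2" using N by (simp add: power2_norm_eq_inner)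
  then show ?thesis using \<rho> by (simp add: m_def)
qed

section \<open>Arcs of the circumcircle\<close>

text \<open>The first zero is the least element of the compact set where \<open>F\<close> is not positive.\<close>

lemma first_zero:
  fixes F :: "real \<Rightarrow> real"
  assumes F: "continuous_on UNIV F" and "x0 < b" "F x0 > 0" "F b < 0"
  obtains z where "x0 < z" "z < b" "F z = 0" "\<And>x. x0 \<le> x \<Longrightarrow> x < z \<Longrightarrow> F x > 0"
proof -
  have "closed {x. F x \<le> 0}" by (intro closed_Collect_le continuous_intros F)
  then have "compact ({x0..b} \<inter> {x. F x \<le> 0})" by (intro compact_Int_closed) auto
  moreover have "b \<in> {x0..b} \<inter> {x. F x \<le> 0}" using assms by simp
  ultimately obtain z where z: "z \<in> {x0..b}" "F z \<le> 0"
    and min: "\<And>x. x \<in> {x0..b} \<Longrightarrow> F x \<le> 0 \<Longrightarrow> z \<le> x"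
    using compact_attains_inf[of "{x0..b} \<inter> {x. F x \<le> 0}"] by blast
  have pos: "F x > 0" if "x0 \<le> x" "x < z" for x
    using min[of x] that z by force
  obtain y where y: "x0 \<le> y" "y \<le> z" "F y = 0"
    using IVT2'[of F z 0 x0] z assms continuous_on_subset[OF F] by auto
  then have "y = z" using min[of y] z by auto
  moreover have "x0 \<noteq> z" "z \<noteq> b" using y \<open>y = z\<close> assms by auto
  ultimately show thesis using that[of z] y z pos by auto
qed

text \<open>This produces the parameter interval of an infertile arc. If \<open>F\<close> is positive at \<open>0\<close>, the interval extends from there to the nearest zeros on both sides; if \<open>0\<close>
  is itself a zero, it becomes an end point, on whichever side \<open>F\<close> is positive.\<close>

lemma positive_interval:
  fixes F :: "real \<Rightarrow> real"
  assumes F: "continuous_on UNIV F" and ab: "a < 0" "0 < b" and neg: "F a < 0" "F b < 0" and F0: "F 0 \<ge> 0"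
    and side: "F 0 = 0 \<Longrightarrow> (\<exists>e>0. \<forall>x. 0 < x \<and> x < e \<longrightarrow> F x > 0) \<or> (\<exists>e>0. \<forall>x. 0 < x \<and> x < e \<longrightarrow> F (- x) > 0)"
  obtains \<alpha> \<beta> where "a < \<alpha>" "\<alpha> \<le> 0" "0 \<le> \<beta>" "\<beta> < b" "\<alpha> < \<beta>" "F \<alpha> = 0" "F \<beta> = 0"
    "\<And>x. \<alpha> < x \<Longrightarrow> x < \<beta> \<Longrightarrow> F x > 0"
proof -
  have right: "\<exists>z. 0 < z \<and> z < b \<and> G z = 0 \<and> (\<forall>x. 0 < x \<and> x < z \<longrightarrow> G x > 0)"
    if G: "continuous_on UNIV G" "0 < b" "G b < 0" and e: "e > 0" "\<And>x. 0 < x \<Longrightarrow> x < e \<Longrightarrow> G x > 0"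
    for G :: "real \<Rightarrow> real" and b e
  proof -
    define x0 where "x0 = min e b / 2"
    have x0: "0 < x0" "x0 < e" "x0 < b" using e G by (auto simp: x0_def min_def)
    then obtain z where "x0 < z" "z < b" "G z = 0" "\<And>x. x0 \<le> x \<Longrightarrow> x < z \<Longrightarrow> G x > 0"
      using first_zero[OF G(1), of x0 b] e G by blast
    then show ?thesis using x0 e(2) by (intro exI[of _ z]) (metis less_trans linorder_not_less)
  qed
  have R: "continuous_on UNIV (\<lambda>x. F (- x))"
    by (intro continuous_on_compose2[OF F] continuous_intros) auto
  show thesis
  proof (cases "F 0 = 0")
    case True
    from side[OF True] show thesis
    proof
      assume "\<exists>e>0. \<forall>x. 0 < x \<and> x < e \<longrightarrow> F x > 0"
      then obtain z where "0 < z" "z < b" "F z = 0" "\<forall>x. 0 < x \<and> x < z \<longrightarrow> F x > 0"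
        using right[OF F ab(2) neg(2)] by blast
      then show thesis using that[of 0 z] True ab by auto
    next
      assume "\<exists>e>0. \<forall>x. 0 < x \<and> x < e \<longrightarrow> F (- x) > 0"
      then obtain e where "e > 0" "\<And>x. 0 < x \<Longrightarrow> x < e \<Longrightarrow> F (- x) > 0" by blast
      then obtain z where z: "0 < z" "z < - a" "F (- z) = 0" "\<forall>x. 0 < x \<and> x < z \<longrightarrow> F (- x) > 0"
        using right[OF R, of "- a" e] ab neg by auto
      have "F x > 0" if "- z < x" "x < 0" for x using z(4)[rule_format, of "- x"] that by simp
      then show thesis using that[of "- z" 0] True ab z by auto
    qed
  next
    case False
    then have pos: "F 0 > 0" using F0 by simp
    obtain z where z: "0 < z" "z < b" "F z = 0" "\<And>x. 0 \<le> x \<Longrightarrow> x < z \<Longrightarrow> F x > 0"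
      using first_zero[OF F ab(2) pos neg(2)] by blast
    obtain y where y: "0 < y" "y < - a" "F (- y) = 0" "\<And>x. 0 \<le> x \<Longrightarrow> x < y \<Longrightarrow> F (- x) > 0"
      using first_zero[OF R, of 0 "- a"] ab pos neg by auto
    have "F x > 0" if "- y < x" "x < z" for x
      using z(4)[of x] y(4)[of "- x"] that by (cases "x \<ge> 0") auto
    then show thesis using that[of "- y" z] y z by auto
  qed
qed

definition circle_point :: "point \<Rightarrow> point \<Rightarrow> real \<Rightarrow> point" where
  "circle_point c A \<theta> = c + cos \<theta> *\<^sub>R (A - c) + sin \<theta> *\<^sub>R rot90 (A - c)"

lemma circle_point_0 [simp]: "circle_point c A 0 = A"
  by (simp add: circle_point_def)

lemma circle_point_periodic: "circle_point c A (\<theta> - 2 * pi) = circle_point c A \<theta>"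
  by (simp add: circle_point_def cos_diff sin_diff)

lemma continuous_circle_point [continuous_intros]:
  fixes f :: "real \<Rightarrow> real"
  shows "continuous_on S f \<Longrightarrow> continuous_on S (\<lambda>t. circle_point c A (f t))"
  unfolding circle_point_def by (intro continuous_intros)

lemma norm_circle_point: "norm (circle_point c A \<theta> - c) = norm (A - c)"
proof -
  have "(circle_point c A \<theta> - c) \<bullet> (circle_point c A \<theta> - c)
      = (cos \<theta> * cos \<theta> + sin \<theta> * sin \<theta>) * ((A - c) \<bullet> (A - c))"
    unfolding circle_point_def by (simp only: inner_real2 rot90_nth vector_add_component
      vector_minus_component vector_scaleR_component real_scaleR_def) algebra
  also have "cos \<theta> * cos \<theta> + sin \<theta> * sin \<theta> = 1" using sin_cos_squared_add2[of \<theta>] by (simp add: power2_eq_square)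
  finally show ?thesis by (simp add: norm_eq_sqrt_inner)
qed

lemma circle_point_crd:
  assumes "A \<noteq> c"
  shows "crd1 (A - c) (circle_point c A \<theta> - c) = cos \<theta>" "crd2 (A - c) (circle_point c A \<theta> - c) = sin \<theta>"
  using crd_simps[of "A - c"] assms by (simp_all add: circle_point_def)

lemma circle_point_surj:
  assumes "A \<noteq> c" "norm (P - c) = norm (A - c)" "P \<noteq> A"
  obtains \<theta> where "0 < \<theta>" "\<theta> < 2 * pi" "P = circle_point c A \<theta>"
proof -
  have a0: "A - c \<noteq> 0" using assms by simp
  let ?x = "crd1 (A - c) (P - c)" and ?y = "crd2 (A - c) (P - c)"
  have "((A - c) \<bullet> (A - c)) * (?x\<^sup>2 + ?y\<^sup>2) = ((A - c) \<bullet> (A - c)) * 1"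
    using inner_crd[OF a0, of "P - c" "P - c"] assms(2) by (simp add: power2_eq_square norm_eq)
  then have "?x\<^sup>2 + ?y\<^sup>2 = 1" using a0 by simp
  then obtain \<theta> where \<theta>: "0 \<le> \<theta>" "\<theta> < 2 * pi" "?x = cos \<theta>" "?y = sin \<theta>"
    using sincos_total_2pi by metis
  then have "P - c = circle_point c A \<theta> - c"
    using circle_point_crd[OF assms(1)] by (intro crd_eqI[OF a0]) auto
  then have "P = circle_point c A \<theta>" by simp
  moreover have "\<theta> \<noteq> 0" using calculation assms(3) by auto
  ultimately show thesis using that[of \<theta>] \<theta>(1,2) by simp
qed

lemma circle_point_inj:
  assumes "A \<noteq> c" "circle_point c A s = circle_point c A t" "\<bar>s - t\<bar> < 2 * pi"
  shows "s = t"
proof -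
  have "cos s = cos t" "sin s = sin t"
    using circle_point_crd[OF assms(1), of s] circle_point_crd[OF assms(1), of t] assms(2) by simp_all
  then obtain n :: int where n: "s = t + 2 * pi * n" using sin_cos_eq_iff by blast
  then have "\<bar>real_of_int n\<bar> < 1" using assms(3) by (simp add: abs_mult)
  then have "n = 0" by linarith
  then show ?thesis using n by simp
qed

lemma infertile_arc_circle_point:
  assumes A: "A \<noteq> c" and ab: "\<alpha> < \<beta>" "\<beta> < \<alpha> + 2 * pi"
    and ends: "circle_point c A \<alpha> \<in> \<gamma>" "circle_point c A \<beta> \<in> \<gamma>"
    and ins: "\<And>\<theta>. \<alpha> < \<theta> \<Longrightarrow> \<theta> < \<beta> \<Longrightarrow> circle_point c A \<theta> \<in> conic_inside \<gamma> \<Phi>"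
  shows "is_infertile_arc (circle_point c A ` {\<alpha>..\<beta>}) (sphere c (norm (A - c))) \<gamma> \<Phi>"
proof -
  define g where "g t = circle_point c A (\<alpha> + t * (\<beta> - \<alpha>))" for t
  have "path g" unfolding path_def g_def by (intro continuous_intros)
  moreover have "inj_on g {0..1}"
  proof (rule inj_onI)
    fix s t :: real assume st: "s \<in> {0..1}" "t \<in> {0..1}" and "g s = g t"
    have "\<bar>(s - t) * (\<beta> - \<alpha>)\<bar> \<le> \<beta> - \<alpha>"
      using st ab mult_right_mono[of "\<bar>s - t\<bar>" 1 "\<beta> - \<alpha>"] by (auto simp: abs_mult)
    then have "\<bar>(\<alpha> + s * (\<beta> - \<alpha>)) - (\<alpha> + t * (\<beta> - \<alpha>))\<bar> < 2 * pi" using ab by (simp add: left_diff_distrib)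
    then show "s = t" using circle_point_inj[OF A \<open>g s = g t\<close>[unfolded g_def]] ab by simp
  qed
  ultimately have "arc g" by (simp add: arc_def)
  have "(\<lambda>t. \<alpha> + t * (\<beta> - \<alpha>)) ` {0..1} = {\<alpha>..\<beta>}"
  proof -
    have "(\<lambda>t. (\<beta> - \<alpha>) * t + \<alpha>) ` {0..1} = {\<alpha>..\<beta>}"
      using image_affinity_atLeastAtMost[of "\<beta> - \<alpha>" \<alpha> 0 1] ab by simp
    then show ?thesis by (simp add: algebra_simps)
  qed
  then have im: "path_image g = circle_point c A ` {\<alpha>..\<beta>}"
    unfolding path_image_def g_def by (metis (no_types, lifting) image_cong image_image)
  have gs: "pathstart g = circle_point c A \<alpha>" "pathfinish g = circle_point c A \<beta>"
    by (simp_all add: pathstart_def pathfinish_def g_def)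
  have "circle_point c A ` {\<alpha>..\<beta>} \<subseteq> sphere c (norm (A - c))"
    using norm_circle_point by (auto simp: dist_norm norm_minus_commute)
  moreover have "circle_point c A ` {\<alpha>..\<beta>} - {pathstart g, pathfinish g} \<subseteq> conic_inside \<gamma> \<Phi>"
    unfolding gs
  proof
    fix X assume "X \<in> circle_point c A ` {\<alpha>..\<beta>} - {circle_point c A \<alpha>, circle_point c A \<beta>}"
    then obtain \<theta> where "\<alpha> \<le> \<theta>" "\<theta> \<le> \<beta>" "X = circle_point c A \<theta>" "\<theta> \<noteq> \<alpha>" "\<theta> \<noteq> \<beta>"
      by (metis Diff_iff atLeastAtMost_iff imageE insertCI)
    then show "X \<in> conic_inside \<gamma> \<Phi>" using ins[of \<theta>] by auto
  qed
  ultimately show ?thesis unfolding is_infertile_arc_def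
    using \<open>arc g\<close> im gs ends by (intro exI[of _ g]) auto
qed

section \<open>Contact of the circumcircle with the i-conic\<close>

text \<open>Along the circle the displacement from \<open>A\<close> is \<open>2 sin (\<theta> / 2)\<close> times a continuous vector. The sign of
  a function near a zero at \<open>A\<close> can therefore be read off after splitting off factors \<open>sin (\<theta> / 2)\<close>.\<close>

lemma half_angle_sign:
  fixes F G :: "real \<Rightarrow> real"
  assumes F: "\<And>\<theta>. F \<theta> = sin (\<theta> / 2) * G \<theta>" and G: "isCont G 0" "G 0 \<noteq> 0"
  shows "(\<exists>e>0. \<forall>x. 0 < x \<and> x < e \<longrightarrow> F x > 0) \<or> (\<exists>e>0. \<forall>x. 0 < x \<and> x < e \<longrightarrow> F (- x) > 0)"
proof -
  have sp: "sin (x / 2) > 0" if "0 < x" "x < 2 * pi" for x :: real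
    using sin_gt_zero[of "x / 2"] that by simp
  obtain e where e: "e > 0" "\<And>x. \<bar>x\<bar> < e \<Longrightarrow> G x * G 0 > 0"
  proof -
    have "isCont (\<lambda>x. G x * G 0) 0" using G by (intro continuous_intros)
    moreover have "G 0 * G 0 > 0" using G by (simp add: zero_less_mult_iff linorder_neq_iff[symmetric])
    ultimately have "eventually (\<lambda>x. G x * G 0 > 0) (at 0)"
      unfolding isCont_def by (rule order_tendstoD(1))
    then obtain e where e: "e > 0" "\<And>x. x \<noteq> 0 \<Longrightarrow> dist x 0 < e \<Longrightarrow> G x * G 0 > 0"
      unfolding eventually_at by blast
    have "G x * G 0 > 0" if "\<bar>x\<bar> < e" for x
      using e(2)[of x] that \<open>G 0 * G 0 > 0\<close> by (cases "x = 0") (auto simp: dist_real_def)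
    with e(1) show thesis using that by blast
  qed
  define d where "d = min e (2 * pi)"
  have d: "d > 0" "\<And>x. 0 < x \<Longrightarrow> x < d \<Longrightarrow> \<bar>x\<bar> < e \<and> x < 2 * pi" using e by (auto simp: d_def)
  show ?thesis
  proof (cases "G 0 > 0")
    case True
    then have "F x > 0" if "0 < x" "x < d" for x
      using e(2)[of x] d(2)[OF that] sp[of x] that by (simp add: F zero_less_mult_iff)
    then show ?thesis using d(1) by blast
  next
    case False
    then have "F (- x) > 0" if "0 < x" "x < d" for x
      using e(2)[of "- x"] d(2)[OF that] sp[of x] that by (simp add: F zero_less_mult_iff mult_less_0_iff)
    then show ?thesis using d(1) by blast
  qed
qed

lemma half_angle_sign_double:
  fixes F H :: "real \<Rightarrow> real"
  assumes F: "\<And>\<theta>. F \<theta> = (sin (\<theta> / 2))\<^sup>2 * H \<theta>" and H: "isCont H 0" "H 0 > 0"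
  shows "\<exists>e>0. \<forall>x. 0 < x \<and> x < e \<longrightarrow> F x > 0"
proof -
  have "eventually (\<lambda>x. H x > 0) (at 0)"
    using H unfolding isCont_def by (rule order_tendstoD(1))
  then obtain e where e: "e > 0" "\<And>x. x \<noteq> 0 \<Longrightarrow> dist x 0 < e \<Longrightarrow> H x > 0"
    unfolding eventually_at by blast
  have "F x > 0" if "0 < x" "x < min e (2 * pi)" for x
  proof -
    have "sin (x / 2) > 0" using sin_gt_zero[of "x / 2"] that by simp
    then show ?thesis using e(2)[of x] that by (simp add: F dist_real_def)
  qed
  then show ?thesis using e(1) by (intro exI[of _ "min e (2 * pi)"]) auto
qed

text \<open>Points with a positive value are inside the conic \<open>sqrt R |x| = |m \<bullet> x - k|\<close> with focus at the origin.\<close>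

definition conic_form :: "point \<Rightarrow> real \<Rightarrow> real \<Rightarrow> point \<Rightarrow> real" where
  "conic_form m k R x = (m \<bullet> x - k)\<^sup>2 - R * (x \<bullet> x)"

text \<open>Where the circle meets the conic, it enters the inside on at least one side: at a simple zero because the sign changes,
  at a double zero because the second-order coefficient is positive.\<close>

lemma conic_form_one_sided:
  assumes r': "r' > 0" and k: "k \<noteq> 0" and k': "k' = u' \<bullet> u' - r'\<^sup>2"
    and por: "poristic k k' u u'"
    and u: "u = c - D" and on: "(A - D) \<bullet> (A - D) - 2 * (u \<bullet> (A - D)) + k = 0"
    and zero: "conic_form (2 *\<^sub>R u - u') k (r'\<^sup>2) (A - D) = 0"
  defines "F \<equiv> \<lambda>\<theta>. conic_form (2 *\<^sub>R u - u') k (r'\<^sup>2) (circle_point c A \<theta> - D)"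
  shows "(\<exists>e>0. \<forall>x. 0 < x \<and> x < e \<longrightarrow> F x > 0) \<or> (\<exists>e>0. \<forall>x. 0 < x \<and> x < e \<longrightarrow> F (- x) > 0)"
proof -
  define a where "a = A - D"
  note on_circle = on[folded a_def]
  define m where "m = 2 *\<^sub>R u - u'"
  define l0 where "l0 = m \<bullet> a - k"
  define R where "R = r'\<^sup>2"
  define g where "g = l0 *\<^sub>R m - R *\<^sub>R a"
  define v where "v = rot90 (a - u)"
  define w where "w = u - a"
  have a0: "a \<noteq> 0" using on_circle k by auto
  have R: "R > 0" using r' by (simp add: R_def)
  have z: "l0\<^sup>2 = R * (a \<bullet> a)" using zero by (simp add: conic_form_def l0_def m_def a_def R_def)
  define s c' where "s \<theta> = sin (\<theta> / 2)" and "c' \<theta> = cos (\<theta> / 2)" for \<theta> :: real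
  define h where "h \<theta> = c' \<theta> *\<^sub>R v + s \<theta> *\<^sub>R w" for \<theta>
  have X: "circle_point c A \<theta> - D = a + (2 * s \<theta>) *\<^sub>R h \<theta>" for \<theta>
  proof -
    have sc: "sin \<theta> = 2 * s \<theta> * c' \<theta>" "cos \<theta> = 1 - 2 * s \<theta> * s \<theta>"
      using sin_double[of "\<theta> / 2"] cos_double_sin[of "\<theta> / 2"] by (simp_all add: s_def c'_def power2_eq_square)
    show ?thesis
      unfolding circle_point_def h_def v_def w_def a_def u sc by (simp add: algebra_simps)
  qed
  have Fe: "F \<theta> = s \<theta> * (4 * (g \<bullet> h \<theta> + s \<theta> * ((m \<bullet> h \<theta>)\<^sup>2 - R * (h \<theta> \<bullet> h \<theta>))))" for \<theta>
  proof -
    have "F \<theta> = (l0 + 2 * s \<theta> * (m \<bullet> h \<theta>))\<^sup>2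
       - R * (a \<bullet> a + 4 * s \<theta> * (a \<bullet> h \<theta>) + 4 * (s \<theta>)\<^sup>2 * (h \<theta> \<bullet> h \<theta>))"
      unfolding F_def X conic_form_def m_def[symmetric] R_def[symmetric] l0_def
      by (simp add: inner_simps inner_commute power2_eq_square algebra_simps)
    also have "\<dots> = s \<theta> * (4 * ((l0 * (m \<bullet> h \<theta>) - R * (a \<bullet> h \<theta>)) + s \<theta> * ((m \<bullet> h \<theta>)\<^sup>2 - R * (h \<theta> \<bullet> h \<theta>))))"
      using z by algebra
    finally show ?thesis by (simp add: g_def inner_simps)
  qed
  have cont: "isCont s 0" "isCont h 0" "isCont c' 0"
    unfolding h_def s_def c'_def by (intro continuous_intros; simp)+
  have at0: "s 0 = 0" "c' 0 = 1" "h 0 = v" by (simp_all add: s_def c'_def h_def)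
  show ?thesis
  proof (cases "g \<bullet> v = 0")
    case False
    show ?thesis
    proof (rule half_angle_sign)
      show "F \<theta> = sin (\<theta> / 2) * (4 * (g \<bullet> h \<theta> + s \<theta> * ((m \<bullet> h \<theta>)\<^sup>2 - R * (h \<theta> \<bullet> h \<theta>))))" for \<theta>
        unfolding Fe s_def ..
      show "isCont (\<lambda>\<theta>. 4 * (g \<bullet> h \<theta> + s \<theta> * ((m \<bullet> h \<theta>)\<^sup>2 - R * (h \<theta> \<bullet> h \<theta>)))) 0"
        by (intro continuous_intros cont)
      show "4 * (g \<bullet> h 0 + s 0 * ((m \<bullet> h 0)\<^sup>2 - R * (h 0 \<bullet> h 0))) \<noteq> 0"
        using False at0 by simp
    qed
  next
    case True
    have gh: "g \<bullet> h \<theta> = s \<theta> * (g \<bullet> w)" for \<theta> using True by (simp add: h_def inner_simps)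
    have pos: "g \<bullet> w + (m \<bullet> v)\<^sup>2 - R * (v \<bullet> v) > 0"
      unfolding w_def
      by (rule double_zero_positive[OF k a0 R _ _ por m_def l0_def z g_def v_def True])
        (use k' on_circle in \<open>simp_all add: R_def\<close>)
    have "\<exists>e>0. \<forall>x. 0 < x \<and> x < e \<longrightarrow> F x > 0"
    proof (rule half_angle_sign_double)
      show "F \<theta> = (sin (\<theta> / 2))\<^sup>2 * (4 * (g \<bullet> w + ((m \<bullet> h \<theta>)\<^sup>2 - R * (h \<theta> \<bullet> h \<theta>))))" for \<theta>
        unfolding Fe gh s_def by (simp add: power2_eq_square algebra_simps)
      show "isCont (\<lambda>\<theta>. 4 * (g \<bullet> w + ((m \<bullet> h \<theta>)\<^sup>2 - R * (h \<theta> \<bullet> h \<theta>)))) 0"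
        by (intro continuous_intros cont)
      show "4 * (g \<bullet> w + ((m \<bullet> h 0)\<^sup>2 - R * (h 0 \<bullet> h 0))) > 0" using pos at0 by simp
    qed
    then show ?thesis ..
  qed
qed

text \<open>Since \<open>P\<close> lies outside the conic, the parameter interval of the arc stops before it reaches \<open>P\<close> in either direction;
  it is therefore shorter than a full turn, and its end points are on the conic.\<close>

lemma infertile_arc_exists:
  assumes r: "r > 0" "r' > 0" and k: "k = u \<bullet> u - r\<^sup>2" "k \<noteq> 0" and k': "k' = u' \<bullet> u' - r'\<^sup>2"
    and por: "poristic k k' u u'" and u: "u = c - D" 
    and A: "A \<in> sphere c r" "conic_form (2 *\<^sub>R u - u') k (r'\<^sup>2) (A - D) \<ge> 0"
    and P: "P \<in> sphere c r" "conic_form (2 *\<^sub>R u - u') k (r'\<^sup>2) (P - D) < 0"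
    and \<gamma>: "\<gamma> = {X. conic_form (2 *\<^sub>R u - u') k (r'\<^sup>2) (X - D) = 0}"
    and ins: "conic_inside \<gamma> \<Phi> = {X. conic_form (2 *\<^sub>R u - u') k (r'\<^sup>2) (X - D) > 0}"
  shows "\<exists>\<Gamma>. is_infertile_arc \<Gamma> (sphere c r) \<gamma> \<Phi> \<and> A \<in> \<Gamma>"
proof -
  define F where "F = (\<lambda>\<theta>. conic_form (2 *\<^sub>R u - u') k (r'\<^sup>2) (circle_point c A \<theta> - D))"
  have nA: "norm (A - c) = r" using A by (simp add: dist_norm norm_minus_commute)
  then have Ac: "A \<noteq> c" using r by auto
  have "norm (P - c) = norm (A - c)" using P nA by (simp add: dist_norm norm_minus_commute)
  moreover have "P \<noteq> A" using A P by auto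
  ultimately obtain \<theta> where \<theta>: "0 < \<theta>" "\<theta> < 2 * pi" "P = circle_point c A \<theta>"
    using circle_point_surj[OF Ac] by blast
  have cont: "continuous_on UNIV F" unfolding F_def conic_form_def by (intro continuous_intros)
  have neg: "F \<theta> < 0" "F (\<theta> - 2 * pi) < 0"
    using P(2) by (simp_all add: F_def circle_point_periodic \<theta>(3)[symmetric])
  have F0: "F 0 \<ge> 0" using A(2) by (simp add: F_def)
  have a: "(A - D) \<bullet> (A - D) - 2 * (u \<bullet> (A - D)) + k = 0"
    using A(1) sphere_iff[OF r(1), of A c D] by (simp add: u k)
  have side: "(\<exists>e>0. \<forall>x. 0 < x \<and> x < e \<longrightarrow> F x > 0) \<or> (\<exists>e>0. \<forall>x. 0 < x \<and> x < e \<longrightarrow> F (- x) > 0)" if "F 0 = 0"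
    unfolding F_def by (rule conic_form_one_sided[OF r(2) k(2) k' por u a]) (use that in \<open>simp add: F_def\<close>)
  \<comment> \<open>both \<open>\<theta>\<close> and \<open>\<theta> - 2 * pi\<close> are parameters of \<open>P\<close>\<close>
  have th: "\<theta> - 2 * pi < 0" using \<theta>(2) by simp
  obtain \<alpha> \<beta> where ab: "\<theta> - 2 * pi < \<alpha>" "\<alpha> \<le> 0" "0 \<le> \<beta>" "\<beta> < \<theta>" "\<alpha> < \<beta>" "F \<alpha> = 0" "F \<beta> = 0"
    "\<And>x. \<alpha> < x \<Longrightarrow> x < \<beta> \<Longrightarrow> F x > 0"
    by (rule positive_interval[OF cont th \<theta>(1) neg(2,1) F0]) (erule side | rule that; assumption)+
  have "is_infertile_arc (circle_point c A ` {\<alpha>..\<beta>}) (sphere c (norm (A - c))) \<gamma> \<Phi>"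
  proof (rule infertile_arc_circle_point[OF Ac ab(5)])
    show "\<beta> < \<alpha> + 2 * pi" using ab by linarith
    show "circle_point c A \<alpha> \<in> \<gamma>" "circle_point c A \<beta> \<in> \<gamma>"
      using ab by (simp_all add: \<gamma> F_def)
    show "circle_point c A t \<in> conic_inside \<gamma> \<Phi>" if "\<alpha> < t" "t < \<beta>" for t
      unfolding ins using ab(8)[OF that] by (simp add: F_def)
  qed
  moreover have "A \<in> circle_point c A ` {\<alpha>..\<beta>}"
    using ab by (intro image_eqI[of _ _ 0]) auto
  ultimately show ?thesis unfolding nA by blast
qed

section \<open>The i-conic and the porism\<close>

text \<open>The given triangle is an instance of the construction, started at \<open>P\<close>, which closes with the vertex \<open>P'\<close>.\<close>

lemma negative_pedal_poristic:
  assumes r: "r > 0" "r' > 0" and D: "D \<notin> sphere c r" and T: "{P, Q, R} \<subseteq> sphere c r" "\<not> collinear {P, Q, R}"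
    and np: "is_negative_pedal_triangle D P Q R P' Q' R'"
    and T': "{P', Q', R'} \<subseteq> sphere c' r'" "\<not> collinear {P', Q', R'}"
  shows "poristic ((c - D) \<bullet> (c - D) - r\<^sup>2) ((c' - D) \<bullet> (c' - D) - r'\<^sup>2) (c - D) (c' - D)"
proof -
  note sph = sphere_iff[OF r(1), of _ c D] and sph' = sphere_iff[OF r(2), of _ c' D]
  have mem: "P' \<in> perp_line D Q" "P' \<in> perp_line D R" "Q' \<in> perp_line D R" "Q' \<in> perp_line D P"
    "R' \<in> perp_line D P" "R' \<in> perp_line D Q"
    using np unfolding is_negative_pedal_triangle_def by blast+
  have ne: "Q' \<noteq> R'" "R \<noteq> P" "Q \<noteq> P" using T(2) T'(2) by (auto simp: insert_commute)
  have PD: "P - D \<noteq> 0" using T(1) D by auto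
  show ?thesis
    by (rule iffD1[OF poncelet_closing(1)[of _ "P - D" "c - D" "Q - D" "R - D" "Q' - D" "R' - D" "c' - D" _ "P' - D"]])
      (use PD ne sphere_misses_focus[OF D r(1)] T(1) T'(1) mem in \<open>simp_all add: perp_line_iff sph sph' del: mem_sphere\<close>)
qed

text \<open>The three tangency conditions imply that \<open>P'\<close>, \<open>Q'\<close>, \<open>R'\<close> lie on a circle whose centre and radius are expressed by the coefficients of the conic.
  Three points determine their circle, so this is the negative-pedal circle, and the coefficients are known up to a common factor.\<close>

lemma i_conic_equation:
  assumes r: "r > 0" "r' > 0" and D: "D \<notin> sphere c r" and T: "{P, Q, R} \<subseteq> sphere c r"
    and np: "is_negative_pedal_triangle D P Q R P' Q' R'"
    and T': "{P', Q', R'} \<subseteq> sphere c' r'" "\<not> collinear {P', Q', R'}"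
    and ic: "is_i_conic \<gamma> \<Phi> D P Q R"
  defines "u \<equiv> c - D" and "u' \<equiv> c' - D"
  defines "k \<equiv> u \<bullet> u - r\<^sup>2"
  shows "\<gamma> = {X. conic_form (2 *\<^sub>R u - u') k (r'\<^sup>2) (X - D) = 0}" (is ?A)
    and "conic_inside \<gamma> \<Phi> = {X. conic_form (2 *\<^sub>R u - u') k (r'\<^sup>2) (X - D) > 0}" (is ?B)
proof -
  have k: "k \<noteq> 0" using sphere_misses_focus[OF D r(1)] by (simp add: k_def u_def)
  obtain \<rho> w \<kappa> where \<rho>: "\<rho> > 0" and \<kappa>: "\<kappa> \<noteq> 0"
    and \<gamma>: "\<gamma> = {X. \<rho> * norm (X - D) = \<bar>w \<bullet> (X - D) + \<kappa>\<bar>}"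
    and ins: "conic_inside \<gamma> \<Phi> = {X. \<rho> * norm (X - D) < \<bar>w \<bullet> (X - D) + \<kappa>\<bar>}"
  proof -
    have "is_conic_with_foci \<gamma> \<Phi>" "D \<in> \<Phi>" using ic unfolding is_i_conic_def by blast+
    from conic_focal_form[OF this that] show thesis .
  qed
  have mem: "P' \<in> perp_line D Q" "P' \<in> perp_line D R" "Q' \<in> perp_line D R" "Q' \<in> perp_line D P"
    "R' \<in> perp_line D P" "R' \<in> perp_line D Q"
    using np unfolding is_negative_pedal_triangle_def by blast+
  define c'' r'' where "c'' = D + 2 *\<^sub>R u + (k / \<kappa>) *\<^sub>R w" and "r'' = \<bar>k / \<kappa>\<bar> * \<rho>"
  have vertex: "Z \<in> sphere c'' r''"
    if X: "X \<in> sphere c r" "Y \<in> sphere c r" "Z \<in> perp_line D X" "Z \<in> perp_line D Y"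
      and t: "is_tangent_line (affine hull {X, Y}) \<gamma>" for X Y Z
  proof -
    \<comment> \<open>the pole of the side \<open>XY\<close> with respect to the unit circle around \<open>D\<close>\<close>
    define n where "n = (1 / k) *\<^sub>R (2 *\<^sub>R u - (Z - D))"
    have pole: "n \<bullet> (V - D) = 1" if "V \<in> sphere c r" "Z \<in> perp_line D V" for V
    proof -
      have "2 * (u \<bullet> (V - D)) - (Z - D) \<bullet> (V - D) = k"
        using that unfolding sphere_iff[OF r(1), of V c D] perp_line_iff u_def k_def by linarith
      then show ?thesis using k by (simp add: n_def inner_diff_left[of "2 *\<^sub>R u"])
    qed
    have l: "affine hull {X, Y} \<subseteq> {V. n \<bullet> (V - D) = 1}"
    proof
      fix V assume "V \<in> affine hull {X, Y}"
      then obtain s where "V = X + s *\<^sub>R (Y - X)" unfolding affine_hull_2_alt by blast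
      then have V: "V - D = (1 - s) *\<^sub>R (X - D) + s *\<^sub>R (Y - D)" by (simp add: algebra_simps)
      have "n \<bullet> (X - D) = 1" "n \<bullet> (Y - D) = 1" using pole X by blast+
      then have "n \<bullet> (V - D) = (1 - s) * 1 + s * 1"
        unfolding V by (simp only: inner_add_right inner_scaleR_right)
      then show "V \<in> {V. n \<bullet> (V - D) = 1}" by simp
    qed
    have "norm (w + \<kappa> *\<^sub>R n) = \<rho>"
      using t touching_line_dual[OF \<gamma> \<rho> l] asymptote_dual[OF \<gamma> \<rho> l] closed_affine_hull
      unfolding is_tangent_line_def by auto
    moreover have "c'' - Z = (k / \<kappa>) *\<^sub>R (w + \<kappa> *\<^sub>R n)"
      using k \<kappa> by (simp add: c''_def n_def algebra_simps)
    ultimately have "norm (c'' - Z) = r''" by (simp add: r''_def)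
    then show ?thesis by (simp add: dist_norm)
  qed
  have tan: "is_tangent_line (affine hull {Q, R}) \<gamma>" "is_tangent_line (affine hull {R, P}) \<gamma>"
    "is_tangent_line (affine hull {P, Q}) \<gamma>"
    using ic unfolding is_i_conic_def sides_def by auto
  have "{P', Q', R'} \<subseteq> sphere c'' r''"
    using vertex[of Q R P'] vertex[of R P Q'] vertex[of P Q R'] tan mem T by auto
  from circle_through_three_points_unique[OF T'(2,1) this]
  have c: "c' = c''" and r'': "r' = r''" by simp_all
  define q where "q = k / \<kappa>"
  have q: "q \<noteq> 0" using k \<kappa> by (simp add: q_def)
  have lin: "(2 *\<^sub>R u - u') \<bullet> x - k = - q * (w \<bullet> x + \<kappa>)" for x
  proof -
    have "2 *\<^sub>R u - u' = - q *\<^sub>R w" using c by (simp add: u'_def c''_def q_def algebra_simps)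
    then show ?thesis using \<kappa> by (simp add: q_def distrib_left)
  qed
  have form: "conic_form (2 *\<^sub>R u - u') k (r'\<^sup>2) x = q\<^sup>2 * ((w \<bullet> x + \<kappa>)\<^sup>2 - (\<rho> * norm x)\<^sup>2)" for x
    unfolding conic_form_def lin r'' r''_def q_def[symmetric] power_mult_distrib power2_abs power2_minus
      power2_norm_eq_inner by (simp add: right_diff_distrib)
  have "\<rho> * norm x = \<bar>w \<bullet> x + \<kappa>\<bar> \<longleftrightarrow> conic_form (2 *\<^sub>R u - u') k (r'\<^sup>2) x = 0"
    "\<rho> * norm x < \<bar>w \<bullet> x + \<kappa>\<bar> \<longleftrightarrow> conic_form (2 *\<^sub>R u - u') k (r'\<^sup>2) x > 0" for x
  proof -
    have n: "0 \<le> \<rho> * norm x" using \<rho> by simp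
    have "\<rho> * norm x = \<bar>w \<bullet> x + \<kappa>\<bar> \<longleftrightarrow> (\<rho> * norm x)\<^sup>2 = (w \<bullet> x + \<kappa>)\<^sup>2"
      using power2_eq_iff_nonneg[OF n, of "\<bar>w \<bullet> x + \<kappa>\<bar>"] by simp
    then show "\<rho> * norm x = \<bar>w \<bullet> x + \<kappa>\<bar> \<longleftrightarrow> conic_form (2 *\<^sub>R u - u') k (r'\<^sup>2) x = 0"
      unfolding form using q by auto
    have "\<rho> * norm x < \<bar>w \<bullet> x + \<kappa>\<bar> \<longleftrightarrow> (\<rho> * norm x)\<^sup>2 < (w \<bullet> x + \<kappa>)\<^sup>2"
      using n abs_le_square_iff[of "w \<bullet> x + \<kappa>" "\<rho> * norm x"] by (auto simp: not_le[symmetric])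
    then show "\<rho> * norm x < \<bar>w \<bullet> x + \<kappa>\<bar> \<longleftrightarrow> conic_form (2 *\<^sub>R u - u') k (r'\<^sup>2) x > 0"
      unfolding form using q by (simp add: zero_less_mult_iff)
  qed
  then show ?A ?B unfolding ins unfolding \<gamma> by simp_all
qed

text \<open>On the circumcircle \<open>2 u \<bullet> x - k = x \<bullet> x\<close>, which turns the equation of the i-conic into that of the distance from the centre of the
  negative-pedal circle to the perpendicular.\<close>

lemma meet_iff_conic_form:
  assumes r: "r > 0" "r' > 0" and D: "D \<notin> sphere c r" and A: "A \<in> sphere c r"
  shows "meet_in_two_points (perp_line D A) (sphere c' r') \<longleftrightarrow>
    conic_form (2 *\<^sub>R (c - D) - (c' - D)) ((c - D) \<bullet> (c - D) - r\<^sup>2) (r'\<^sup>2) (A - D) < 0"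
proof -
  have AD: "A \<noteq> D" using A D by auto
  have e: "(2 *\<^sub>R (c - D) - (c' - D)) \<bullet> (A - D) - ((c - D) \<bullet> (c - D) - r\<^sup>2)
      = - ((c' - D) \<bullet> (A - D) - (A - D) \<bullet> (A - D))"
    using A unfolding sphere_iff[OF r(1), of A c D] inner_diff_left[of "2 *\<^sub>R (c - D)"] inner_scaleR_left
    by linarith
  show ?thesis
    unfolding meet_in_two_points_iff[OF AD r(2)] conic_form_def e power2_minus by simp
qed

text \<open>If \<open>B = C'\<close> or \<open>C = B'\<close>, one of the hulls is a single point instead of a line. Then it does not meet the other hull,
  so that the second claim is about genuine triangles only.\<close>

lemma poristic_triangle:
  assumes r: "r > 0" "r' > 0" and D: "D \<notin> sphere c r" and A: "A \<in> sphere c r"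
    and por: "poristic ((c - D) \<bullet> (c - D) - r\<^sup>2) ((c' - D) \<bullet> (c' - D) - r'\<^sup>2) (c - D) (c' - D)"
    and B'C': "B' \<noteq> C'" "perp_line D A \<inter> sphere c' r' = {B', C'}"
    and C: "C \<noteq> A" "diameter_circle B' D \<inter> sphere c r = {A, C}"
    and B: "B \<noteq> A" "diameter_circle C' D \<inter> sphere c r = {A, B}"
  shows "B \<noteq> C' \<Longrightarrow> C \<noteq> B' \<Longrightarrow> \<exists>A'. affine hull {B, C'} \<inter> affine hull {C, B'} = {A'}" (is "_ \<Longrightarrow> _ \<Longrightarrow> ?ex")
    and "affine hull {B, C'} \<inter> affine hull {C, B'} = {A'} \<Longrightarrow>
      A' \<in> sphere c' r' \<and> is_circumcircle (sphere c' r') A' B' C' \<and> is_pedal_circle (sphere c r) D A' B' C'"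
proof -
  note sph = sphere_iff[OF r(1), of _ c D] and sph' = sphere_iff[OF r(2), of _ c' D]
  have mem: "B' \<in> perp_line D A" "C' \<in> perp_line D A" "B' \<in> sphere c' r'" "C' \<in> sphere c' r'"
    "B \<in> sphere c r" "C \<in> sphere c r" "B' \<in> perp_line D C" "C' \<in> perp_line D B"
    using B'C' B C diameter_circle_iff perp_line_iff by blast+
  have VD: "A \<noteq> D" "B \<noteq> D" "C \<noteq> D" using A mem D by auto
  have BC: "B \<noteq> C"
    using perp_line_foot_unique[OF VD(1,3) B'C'(1) mem(1,2)] mem(7,8) C(1) by auto
  note pc = poncelet_closing[of _ "A - D" "c - D" "B - D" "C - D" "B' - D" "C' - D" "c' - D",
      OF sphere_misses_focus[OF D r(1)]]
  have indep: "(B - D) \<bullet> rot90 (C - D) \<noteq> 0"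
    by (rule pc(2)[OF _ _ _ _ _ _ _ _ _ _ _ _ _ por])
      (use VD A B'C'(1) B(1) C(1) mem in \<open>simp_all add: perp_line_iff sph sph' del: mem_sphere\<close>)
  have on: "X \<in> sphere c' r'" if "X \<in> perp_line D B" "X \<in> perp_line D C" for X
    unfolding sph'
    by (rule iffD2[OF pc(1) por])
      (use VD A B'C'(1) B(1) C(1) mem that in \<open>simp_all add: perp_line_iff sph sph' del: mem_sphere\<close>)
  have self: "B \<in> perp_line D B" "C \<in> perp_line D C" by (simp_all add: perp_line_iff)
  have hB: "affine hull {B, C'} = perp_line D B" if "B \<noteq> C'"
    by (rule affine_hull_eq_perp_line) (use VD self mem that in auto)
  have hC: "affine hull {C, B'} = perp_line D C" if "C \<noteq> B'"
    by (rule affine_hull_eq_perp_line) (use VD self mem that in auto)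
  show ?ex if "B \<noteq> C'" "C \<noteq> B'"
    using perp_lines_meet[OF indep] hB hC that by metis
  assume A': "affine hull {B, C'} \<inter> affine hull {C, B'} = {A'}"
  have nB: "C' \<notin> perp_line D C"
    using perp_line_foot_unique[OF VD(1,3) B'C'(1) mem(1,2,7)] C(1) by auto
  have nC: "B' \<notin> perp_line D B"
    using perp_line_foot_unique[OF VD(1,2) B'C'(1) mem(1,2)] mem(8) B(1) by auto
  have "A' \<in> affine hull {B, C'} \<inter> affine hull {C, B'}" unfolding A' by simp
  then have m: "A' \<in> affine hull {B, C'}" "A' \<in> affine hull {C, B'}" by simp_all
  have neB: "B \<noteq> C'"
  proof
    assume "B = C'"
    then have "A' = C'" using m(1) by simp
    then have C': "C' \<in> affine hull {C, B'}" using m(2) by simp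
    show False
    proof (cases "C = B'")
      case True
      then show False using C' B'C'(1) by simp
    next
      case False
      then show False using C' nB hC by simp
    qed
  qed
  have neC: "C \<noteq> B'"
  proof
    assume "C = B'"
    then have "A' = B'" using m(2) by simp
    then have "B' \<in> affine hull {B, C'}" using m(1) by simp
    then show False using nC hB[OF neB] by simp
  qed
  have A'p: "A' \<in> perp_line D B" "A' \<in> perp_line D C" using m hB[OF neB] hC[OF neC] by simp_all
  have A's: "A' \<in> sphere c' r'" by (rule on[OF A'p])
  have ne: "A' \<noteq> B'" "C' \<noteq> A'" using A'p nB nC by metis+
  have "is_circumcircle (sphere c' r') A' B' C'"
    unfolding is_circumcircle_def is_circle_def
    using sphere_not_collinear[OF A's mem(3,4)] ne B'C'(1) A's mem(3,4) r(2) by blast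
  moreover have "is_circumcircle (sphere c r) A B C"
    unfolding is_circumcircle_def is_circle_def
    using sphere_not_collinear[OF A mem(5,6)] BC B(1) C(1) A mem(5,6) r(1) by blast
  then have "is_pedal_circle (sphere c r) D A' B' C'"
    unfolding is_pedal_circle_def
    using projection_on_perp_line VD mem A'p ne B'C'(1) by metis
  ultimately show "A' \<in> sphere c' r' \<and> is_circumcircle (sphere c' r') A' B' C' \<and> is_pedal_circle (sphere c r) D A' B' C'"
    using A's by blast
qed

theorem proposition8:
  fixes P Q R D P' Q' R' A :: point
    and \<C> \<C>\<^sub>D :: "point set"
  assumes "is_circumcircle \<C> P Q R"
    and "D \<notin> \<Union> (sides P Q R)"
    and "D \<notin> \<C>"
    and "is_negative_pedal_triangle D P Q R P' Q' R'"
    and "is_circumcircle \<C>\<^sub>D P' Q' R'"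
    and "A \<in> \<C>"
  shows "(\<forall>B' C' B C.
            B' \<noteq> C' \<and> perp_line D A \<inter> \<C>\<^sub>D = {B', C'} \<and>
            C \<noteq> A \<and> diameter_circle B' D \<inter> \<C> = {A, C} \<and>
            B \<noteq> A \<and> diameter_circle C' D \<inter> \<C> = {A, B} \<longrightarrow>
            (B \<noteq> C' \<and> C \<noteq> B' \<longrightarrow>
               (\<exists>A'. affine hull {B, C'} \<inter> affine hull {C, B'} = {A'})) \<and>
            (\<forall>A'. affine hull {B, C'} \<inter> affine hull {C, B'} = {A'} \<longrightarrow>
               A' \<in> \<C>\<^sub>D \<and>
               is_circumcircle \<C>\<^sub>D A' B' C' \<and>
               is_pedal_circle \<C> D A' B' C' \<and> is_pedal_circle \<C> D P' Q' R')) \<and>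
         (\<not> meet_in_two_points (perp_line D A) \<C>\<^sub>D \<longrightarrow>
            \<not> (\<exists>B C. is_circumcircle \<C> A B C \<and> is_negative_pedal_circle \<C>\<^sub>D D A B C)) \<and>
         (\<forall>\<gamma> \<Phi>. is_i_conic \<gamma> \<Phi> D P Q R \<longrightarrow>
            (\<not> meet_in_two_points (perp_line D A) \<C>\<^sub>D \<longleftrightarrow>
               (\<exists>\<Gamma>. is_infertile_arc \<Gamma> \<C> \<gamma> \<Phi> \<and> A \<in> \<Gamma>)))"
proof -
  obtain c r where r: "r > 0" and K: "\<C> = sphere c r"
    using assms(1) unfolding is_circumcircle_def is_circle_def by blast
  obtain c' r' where r': "r' > 0" and K': "\<C>\<^sub>D = sphere c' r'"
    using assms(5) unfolding is_circumcircle_def is_circle_def by blast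
  have T: "{P, Q, R} \<subseteq> sphere c r" "\<not> collinear {P, Q, R}"
    and T': "{P', Q', R'} \<subseteq> sphere c' r'" "\<not> collinear {P', Q', R'}"
    using assms(1,5) unfolding is_circumcircle_def K K' by blast+
  have D: "D \<notin> sphere c r" and A: "A \<in> sphere c r" using assms(3,6) K by auto
  have AD: "A \<noteq> D" using A D by auto
  have mem: "P' \<in> perp_line D Q" "P' \<in> perp_line D R" "Q' \<in> perp_line D R" "Q' \<in> perp_line D P"
    "R' \<in> perp_line D P" "R' \<in> perp_line D Q"
    using assms(4) unfolding is_negative_pedal_triangle_def by blast+
  have ne: "P' \<noteq> Q'" "Q' \<noteq> R'" "R' \<noteq> P'" using T'(2) by (auto simp: insert_commute)
  have VD: "P \<noteq> D" "Q \<noteq> D" "R \<noteq> D" using T D by auto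
  note por = negative_pedal_poristic[OF r r' D T assms(4) T']
  have ped: "is_pedal_circle \<C> D P' Q' R'"
    unfolding is_pedal_circle_def
    using projection_on_perp_line VD mem ne assms(1) by metis
  have part1: "\<forall>B' C' B C.
            B' \<noteq> C' \<and> perp_line D A \<inter> \<C>\<^sub>D = {B', C'} \<and>
            C \<noteq> A \<and> diameter_circle B' D \<inter> \<C> = {A, C} \<and>
            B \<noteq> A \<and> diameter_circle C' D \<inter> \<C> = {A, B} \<longrightarrow>
            (B \<noteq> C' \<and> C \<noteq> B' \<longrightarrow>
               (\<exists>A'. affine hull {B, C'} \<inter> affine hull {C, B'} = {A'})) \<and>
            (\<forall>A'. affine hull {B, C'} \<inter> affine hull {C, B'} = {A'} \<longrightarrow>
               A' \<in> \<C>\<^sub>D \<and>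
               is_circumcircle \<C>\<^sub>D A' B' C' \<and>
               is_pedal_circle \<C> D A' B' C' \<and> is_pedal_circle \<C> D P' Q' R')"
  proof (intro allI impI)
    fix B' C' B C
    assume H: "B' \<noteq> C' \<and> perp_line D A \<inter> \<C>\<^sub>D = {B', C'} \<and>
            C \<noteq> A \<and> diameter_circle B' D \<inter> \<C> = {A, C} \<and>
            B \<noteq> A \<and> diameter_circle C' D \<inter> \<C> = {A, B}"
    note t = poristic_triangle[OF r r' D A por, of B' C' C B]
    show "(B \<noteq> C' \<and> C \<noteq> B' \<longrightarrow>
               (\<exists>A'. affine hull {B, C'} \<inter> affine hull {C, B'} = {A'})) \<and>
            (\<forall>A'. affine hull {B, C'} \<inter> affine hull {C, B'} = {A'} \<longrightarrow>
               A' \<in> \<C>\<^sub>D \<and>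
               is_circumcircle \<C>\<^sub>D A' B' C' \<and>
               is_pedal_circle \<C> D A' B' C' \<and> is_pedal_circle \<C> D P' Q' R')"
      using t H ped unfolding K K' by auto
  qed
  have part2: "meet_in_two_points (perp_line D A) \<C>\<^sub>D"
    if neg: "is_negative_pedal_circle \<C>\<^sub>D D A B C" for B C
  proof -
    obtain A' B' C' where np: "is_negative_pedal_triangle D A B C A' B' C'"
      and cc: "is_circumcircle \<C>\<^sub>D A' B' C'"
      using neg unfolding is_negative_pedal_circle_def by blast
    have "B' \<noteq> C'" "{B', C'} \<subseteq> sphere c' r'"
      using cc unfolding is_circumcircle_def K' by (auto simp: insert_commute)
    moreover have "{B', C'} \<subseteq> perp_line D A"
      using np unfolding is_negative_pedal_triangle_def by blast
    ultimately show ?thesis unfolding K' using meet_in_two_pointsI[OF AD] by blast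
  qed
  have part3: "\<not> meet_in_two_points (perp_line D A) \<C>\<^sub>D \<longleftrightarrow>
      (\<exists>\<Gamma>. is_infertile_arc \<Gamma> \<C> \<gamma> \<Phi> \<and> A \<in> \<Gamma>)" if ic: "is_i_conic \<gamma> \<Phi> D P Q R" for \<gamma> \<Phi>
  proof -
    note eq = i_conic_equation[OF r r' D T(1) assms(4) T' ic]
    note meet = meet_iff_conic_form[OF r r' D, of _ c']
    have "meet_in_two_points (perp_line D P) (sphere c' r')"
      by (rule meet_in_two_pointsI[OF VD(1) ne(2)]) (use mem T' in auto)
    then have P: "P \<in> sphere c r"
      "conic_form (2 *\<^sub>R (c - D) - (c' - D)) ((c - D) \<bullet> (c - D) - r\<^sup>2) (r'\<^sup>2) (P - D) < 0"
      using meet[of P] T by auto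
    show ?thesis
    proof
      assume "\<not> meet_in_two_points (perp_line D A) \<C>\<^sub>D"
      then have "conic_form (2 *\<^sub>R (c - D) - (c' - D)) ((c - D) \<bullet> (c - D) - r\<^sup>2) (r'\<^sup>2) (A - D) \<ge> 0"
        using meet[OF A] by (simp add: K')
      from infertile_arc_exists[OF r r' refl sphere_misses_focus[OF D r] refl por refl A this P eq]
      show "\<exists>\<Gamma>. is_infertile_arc \<Gamma> \<C> \<gamma> \<Phi> \<and> A \<in> \<Gamma>" unfolding K .
    next
      assume "\<exists>\<Gamma>. is_infertile_arc \<Gamma> \<C> \<gamma> \<Phi> \<and> A \<in> \<Gamma>"
      then have "A \<in> \<gamma> \<or> A \<in> conic_inside \<gamma> \<Phi>" unfolding is_infertile_arc_def by blast
      then show "\<not> meet_in_two_points (perp_line D A) \<C>\<^sub>D"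
        unfolding eq(2) unfolding eq(1) K' meet[OF A] by auto
    qed
  qed
  show ?thesis using part1 part2 part3 by blast
qed

end
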